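(* The constant $k_G^{\mathbb C}$ is the smallest positive real $\beta$ such that for every natural number $n$ and every real $\alpha$ with $\alpha\ge\beta$ we have $$\mathcal Q_n\subseteq \alpha\,\mathcal R_n - M_n(\mathbb C)_+ .$$
   Context: $M_n(\mathbb C)_+$ is the cone of positive (semidefinite) complex $n\times n$ matrices. $\mathcal Q_n=\{X\in M_n(\mathbb C): X\ge0,\ \mathrm{diag}(X)=I_n\}$, i.e. positive semidefinite matrices with all diagonal entries equal to $1$. $\mathcal R_n$ is the closed convex hull of the rank one matrices $(\overline{u_i}\,u_j)_{i,j}$, where $u\in\mathbb C^n$ with $|u_j|=1$ for all $j$. $\alpha\mathcal R_n-M_n(\mathbb C)_+=\{\alpha R-P: R\in\mathcal R_n, P\in M_n(\mathbb C)_+\}$. $k_G^{\mathbb C}$ is the little Grothendieck constant: the smallest constant $k$ such that $\|X\|_{cbF}\le\sqrt{k}\,\|X\|_F$ for all $m,n$ and all complex $m\times n$ matrices $X$ (known value $4/\pi$). Here $\|X\|_F$ is the norm of $X$ as an operator from $(\mathbb C^n,\|\cdot\|_\infty)$ (max norm) to $(\mathbb C^m,\|\cdot\|_2)$, and $\|X\|_{cbF}$ is the completely bounded norm of this operator (into the column Hilbert space), concretely $\|X\|_{cbF}=\min\{\|B\|_\infty: X=B\Delta_n(\xi),\ \xi_j\ge0,\ \|\xi\|_2=1\}$, where $\|B\|_\infty$ is the operator norm and $\Delta_n(\xi)$ is the diagonal matrix with diagonal $\xi$. *)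

theory Defs
  imports "Jordan_Normal_Form.Matrix" "HOL-Analysis.L2_Norm"
begin

section \<open>Matrix cones and convex sets\<close>

text \<open>The order on \<^typ>\<open>complex\<close> is that of Complex\_Order: $0 \le z$ means that $z$ is real and
  nonnegative. Over the complex numbers this makes a positive matrix Hermitian.\<close>

definition psd_mats :: "nat \<Rightarrow> complex mat set" where
  "psd_mats n = {A \<in> carrier_mat n n. \<forall>v \<in> carrier_vec n. 0 \<le> (A *\<^sub>v v) \<bullet>c v}"

definition Q_set :: "nat \<Rightarrow> complex mat set" where
  "Q_set n = {X \<in> psd_mats n. \<forall>i<n. X $$ (i, i) = 1}"

definition convex_mats :: "complex mat set \<Rightarrow> bool" where
  "convex_mats S \<longleftrightarrow> (\<forall>A\<in>S. \<forall>B\<in>S. \<forall>t::real. 0 \<le> t \<longrightarrow> t \<le> 1 \<longrightarrow>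
     complex_of_real (1 - t) \<cdot>\<^sub>m A + complex_of_real t \<cdot>\<^sub>m B \<in> S)"

text \<open>The type of matrices of arbitrary dimensions carries no topology, so closedness (in the
  finite-dimensional space of $n \times n$ matrices) is spelled out through entrywise limits.\<close>

definition closed_mats :: "nat \<Rightarrow> complex mat set \<Rightarrow> bool" where
  "closed_mats n S \<longleftrightarrow> (\<forall>A. \<forall>L \<in> carrier_mat n n. (\<forall>k::nat. A k \<in> S) \<longrightarrow>
     (\<forall>i<n. \<forall>j<n. (\<lambda>k. A k $$ (i, j)) \<longlonglongrightarrow> L $$ (i, j)) \<longrightarrow> L \<in> S)"

definition closed_convex_hull_mats :: "nat \<Rightarrow> complex mat set \<Rightarrow> complex mat set" where
  "closed_convex_hull_mats n G =
     (\<lambda>S. S \<subseteq> carrier_mat n n \<and> convex_mats S \<and> closed_mats n S) hull G"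

definition R_set :: "nat \<Rightarrow> complex mat set" where
  "R_set n = closed_convex_hull_mats n
     {mat n n (\<lambda>(i, j). cnj (u $ i) * u $ j) | u. u \<in> carrier_vec n \<and> (\<forall>j<n. cmod (u $ j) = 1)}"

definition R_minus_psd :: "nat \<Rightarrow> real \<Rightarrow> complex mat set" where
  "R_minus_psd n \<alpha> = {complex_of_real \<alpha> \<cdot>\<^sub>m R - P | R P. R \<in> R_set n \<and> P \<in> psd_mats n}"

section \<open>The norms and the little Grothendieck constant\<close>

definition l2_norm :: "complex vec \<Rightarrow> real" where
  "l2_norm v = L2_set (\<lambda>i. cmod (v $ i)) {..<dim_vec v}"

definition op_norm :: "complex mat \<Rightarrow> real" where
  "op_norm B = (SUP v \<in> {v \<in> carrier_vec (dim_col B). l2_norm v \<le> 1}. l2_norm (B *\<^sub>v v))"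

definition F_norm :: "complex mat \<Rightarrow> real" where
  "F_norm X = (SUP v \<in> {v \<in> carrier_vec (dim_col X). \<forall>j<dim_col X. cmod (v $ j) \<le> 1}.
     l2_norm (X *\<^sub>v v))"

text \<open>The completely bounded norm of $X$ from $\ell^\infty_n$ into the column Hilbert space, in its
  concrete form as a minimum over factorizations $X = B \Delta_n(\xi)$. The minimum is attained, so
  it is the infimum. A matrix without columns has no such factorization (there is no unit $\xi$), so
  the value is meaningful only for \<^term>\<open>dim_col X \<ge> 1\<close>.\<close>

definition cbF_norm :: "complex mat \<Rightarrow> real" where
  "cbF_norm X = Inf {op_norm B | B \<xi>.
     B \<in> carrier_mat (dim_row X) (dim_col X) \<and>
     (\<forall>j<dim_col X. (0::real) \<le> \<xi> j) \<and> L2_set \<xi> {..<dim_col X} = 1 \<and>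
     X = B * mat_diag (dim_col X) (\<lambda>j. complex_of_real (\<xi> j))}"

definition little_Grothendieck_const :: real where
  "little_Grothendieck_const = (LEAST k. 0 \<le> k \<and>
     (\<forall>m\<ge>1. \<forall>n\<ge>1. \<forall>X \<in> carrier_mat m n. cbF_norm X \<le> sqrt k * F_norm X))"

end

theory Submission
  imports Defs
begin

text \<open>
  Fix $k > 0$. The inequality $\|X\|_{cbF} \le \sqrt k\, \|X\|_F$ for all $X$ and the inclusion
  $\mathcal Q_n \subseteq k \mathcal R_n - M_n(\mathbb C)_+$ for all $n$ are dual to each other,
  under the pairing $\langle A, B\rangle = \mathrm{Re} \sum_{i,j} A_{ij} \overline{B_{ij}}$ applied
  to the Gram matrix $A = X^* X$. On the one hand, $\|X\|_F^2$ is the maximum of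
  $\langle X^* X, R\rangle$ over $R \in \mathcal R_n$: unimodular vectors suffice, since a vector $u$
  in the unit polydisc satisfies $\bar u u^T \le R$ for some $R \in \mathcal R_n$
  (\<open>Rdom_outer\<close>). On the other hand, $\|X\|_{cbF}^2$ is the infimum of the traces of the diagonal
  matrices $D \ge X^* X$, and this equals the maximum of $\langle X^* X, Q\rangle$ over
  $Q \in \mathcal Q_n$.

  Both directions of the equivalence \<open>Grothendieck_bound_iff\<close> follow from one separation statement,
  \<open>psd_separation\<close>: if a Hermitian $X$ does not lie in $C - M_n(\mathbb C)_+$, where $C$ is compact,
  convex and consists of Hermitian matrices, then some positive semidefinite $H$ strictly separates
  $X$ from $C$. The matrix $H$ is the shortest element of $X - C + M_n(\mathbb C)_+$. With
  $C = k \mathcal R_n$ a matrix $Q \in \mathcal Q_n$ outside $k \mathcal R_n - M_n(\mathbb C)_+$ gives a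
  positive semidefinite $H = X^* X$ with $\|X\|_{cbF}^2 \ge \langle H, Q\rangle > k \|X\|_F^2$
  (\<open>Rdom_of_Grothendieck_bound\<close>). With $C$ the diagonal matrices $D \ge 0$ of trace
  $s = k \|X\|_F^2$ it yields $D \ge X^* X$ in $C$, hence a factorization of $X$ of norm at most
  $\sqrt s$, up to a perturbation (\<open>diagonal_domination\<close>, \<open>Grothendieck_bound_of_Rdom\<close>).

  The constant is defined as a least element, so its existence has to be shown as well. The set of
  admissible $k$ is closed and bounded below by $1$, and it remains to find one admissible $k$, that
  is, to prove the little Grothendieck inequality with some constant. The inclusion is shown for
  $k = 49$ (\<open>Rdom_uniform_bound\<close>). Write a positive semidefinite $Q$ with diagonal at most $1$ as the
  average of $\bar g g^T$ over random sign combinations $g$ of finitely many vectors; then the fourth moments of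
  the coordinates are at most $3$ (\<open>random_signs\<close>). Truncating the coordinates at $\sqrt{12}$ gives
  $Q \le 24 R + \frac12 Q'$ with $R \in \mathcal R_n$ and $Q'$ of the same kind as $Q$. Iterating this,
  from the crude bound $Q' \le n R'$, improves the constant $n$ to $48 + n/2^N$.

  Matrices are handled as functions of two indices, of which only the values at indices below $n$
  matter.
\<close>

section \<open>Positive semidefinite kernels\<close>

text \<open>The quadratic form $\sum_{i,j<n} f_{ij} v_j \overline{v_i} = \langle f v, v\rangle$.\<close>

definition qform :: "nat \<Rightarrow> (nat \<Rightarrow> nat \<Rightarrow> complex) \<Rightarrow> (nat \<Rightarrow> complex) \<Rightarrow> complex" where
  "qform n f v = (\<Sum>i<n. \<Sum>j<n. f i j * v j * cnj (v i))"

text \<open>Positive semidefiniteness of the leading $n \times n$ block. As in \<^const>\<open>psd_mats\<close>, the order is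
  that of the complex numbers, so the form is required to be real and nonnegative.\<close>

definition psd :: "nat \<Rightarrow> (nat \<Rightarrow> nat \<Rightarrow> complex) \<Rightarrow> bool" where
  "psd n f \<longleftrightarrow> (\<forall>v. 0 \<le> qform n f v)"

text \<open>The rank one matrix $(\overline{u_i}\, u_j)_{i,j}$, conjugated in the first index as in the
  generators of \<^const>\<open>R_set\<close>.\<close>

definition outer :: "(nat \<Rightarrow> complex) \<Rightarrow> nat \<Rightarrow> nat \<Rightarrow> complex" where
  "outer u i j = cnj (u i) * u j"

text \<open>The real part of the Frobenius inner product of the leading $n \times n$ blocks.\<close>

definition frob :: "nat \<Rightarrow> (nat \<Rightarrow> nat \<Rightarrow> complex) \<Rightarrow> (nat \<Rightarrow> nat \<Rightarrow> complex) \<Rightarrow> real" where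
  "frob n f g = (\<Sum>i<n. \<Sum>j<n. Re (f i j * cnj (g i j)))"

lemma qform_add: "qform n (\<lambda>i j. f i j + g i j) v = qform n f v + qform n g v"
  by (simp add: qform_def sum.distrib algebra_simps)

lemma qform_diff: "qform n (\<lambda>i j. f i j - g i j) v = qform n f v - qform n g v"
  by (simp add: qform_def sum_subtractf algebra_simps)

lemma qform_scale: "qform n (\<lambda>i j. c * f i j) v = c * qform n f v"
  by (simp add: qform_def sum_distrib_left algebra_simps)

lemma qform_cong:
  assumes "\<And>i j. i < n \<Longrightarrow> j < n \<Longrightarrow> f i j = g i j" "\<And>i. i < n \<Longrightarrow> v i = w i"
  shows "qform n f v = qform n g w"
  unfolding qform_def using assms by (intro sum.cong) auto

lemma qform_outer: "qform n (outer u) v = complex_of_real ((cmod (\<Sum>j<n. u j * v j))\<^sup>2)"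
proof -
  have "qform n (outer u) v = (\<Sum>i<n. \<Sum>j<n. cnj (u i * v i) * (u j * v j))"
    by (simp add: qform_def outer_def algebra_simps)
  also have "\<dots> = cnj (\<Sum>j<n. u j * v j) * (\<Sum>j<n. u j * v j)"
    by (simp add: sum_product)
  also have "\<dots> = complex_of_real ((cmod (\<Sum>j<n. u j * v j))\<^sup>2)"
    unfolding complex_norm_square by (rule mult.commute)
  finally show ?thesis .
qed

lemma psd_cong:
  assumes "\<And>i j. i < n \<Longrightarrow> j < n \<Longrightarrow> f i j = g i j"
  shows "psd n f \<longleftrightarrow> psd n g"
  unfolding psd_def using qform_cong[of n f g] assms by metis

lemma psd_add: "psd n f \<Longrightarrow> psd n g \<Longrightarrow> psd n (\<lambda>i j. f i j + g i j)"
  by (simp add: psd_def qform_add)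

lemma psd_scale: "0 \<le> c \<Longrightarrow> psd n f \<Longrightarrow> psd n (\<lambda>i j. complex_of_real c * f i j)"
  by (simp add: psd_def qform_scale less_eq_complex_def)

lemma psd_zero: "psd n (\<lambda>i j. 0)"
  by (simp add: psd_def qform_def)

lemma psd_outer: "psd n (outer u)"
  by (simp add: psd_def qform_outer less_eq_complex_def flip: of_real_power)

lemma psd_sum_list:
  "(\<And>x. x \<in> set xs \<Longrightarrow> psd n (F x)) \<Longrightarrow> psd n (\<lambda>i j. \<Sum>x\<leftarrow>xs. F x i j)"
  by (induction xs) (auto intro: psd_add psd_zero)

lemma qform_shift:
  assumes "p < n"
  shows "qform n f (\<lambda>k. v k + (if k = p then t else 0)) =
     qform n f v + t * (\<Sum>i<n. f i p * cnj (v i)) + cnj t * (\<Sum>j<n. f p j * v j) + t * cnj t * f p p"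
proof -
  have "qform n f (\<lambda>k. v k + (if k = p then t else 0)) =
     (\<Sum>i<n. \<Sum>j<n. f i j * v j * cnj (v i) + (if j = p then f i p * t * cnj (v i) else 0)
        + (if i = p then f p j * v j * cnj t else 0)
        + (if i = p then if j = p then f p p * t * cnj t else 0 else 0))"
    unfolding qform_def by (intro sum.cong refl) (auto simp: algebra_simps)
  also have "\<dots> = qform n f v + (\<Sum>i<n. f i p * t * cnj (v i)) + (\<Sum>j<n. f p j * v j * cnj t)
        + f p p * t * cnj t"
  proof -
    have a: "(\<Sum>i<n. \<Sum>j<n. (if i = p then f p j * v j * cnj t else 0)) = (\<Sum>j<n. f p j * v j * cnj t)"
      using assms by (subst sum.swap) (simp add: sum.delta)
    have b: "(\<Sum>i<n. \<Sum>j<n. (if i = p then if j = p then f p p * t * cnj t else 0 else 0)) = f p p * t * cnj t"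
      using assms by (subst sum.swap) (simp add: sum.delta)
    show ?thesis
      using assms by (simp add: sum.distrib qform_def a b)
  qed
  finally show ?thesis
    by (simp add: sum_distrib_left algebra_simps)
qed

lemma qform_two:
  assumes "i < n" "j < n"
  shows "qform n f (\<lambda>k. (if k = i then x else 0) + (if k = j then y else 0)) =
     x * cnj x * f i i + y * cnj x * f i j + x * cnj y * f j i + y * cnj y * f j j"
proof -
  have 0: "qform n f (\<lambda>k. 0 + (if k = i then x else 0)) = x * cnj x * f i i"
    using qform_shift[OF assms(1), of f "\<lambda>_. 0" x] by (simp add: qform_def)
  have 1: "(\<Sum>k<n. f k j * cnj (if k = i then x else 0)) = f i j * cnj x"
    using assms by (simp add: if_distrib[of cnj] if_distrib[of "\<lambda>z. _ * z"] cong: if_cong)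
  have 2: "(\<Sum>k<n. f j k * (if k = i then x else 0)) = f j i * x"
    using assms by (simp add: if_distrib[of "\<lambda>z. _ * z"] cong: if_cong)
  show ?thesis
    using qform_shift[OF assms(2), of f "\<lambda>k. if k = i then x else 0" y] 0
    unfolding 1 2 by (simp add: algebra_simps)
qed

lemma psd_diag:
  assumes "psd n f" "i < n"
  shows "f i i = complex_of_real (Re (f i i))" "0 \<le> Re (f i i)"
proof -
  have "0 \<le> qform n f (\<lambda>k. (if k = i then 1 else 0) + (if k = i then 0 else 0))"
    using assms(1) unfolding psd_def by blast
  then have "0 \<le> f i i" unfolding qform_two[OF assms(2,2)] by simp
  then show "f i i = complex_of_real (Re (f i i))" "0 \<le> Re (f i i)"
    by (auto simp: less_eq_complex_def complex_eq_iff)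
qed

lemma psd_hermitian:
  assumes "psd n f" "i < n" "j < n"
  shows "f j i = cnj (f i j)"
proof -
  have *: "0 \<le> x * cnj x * f i i + y * cnj x * f i j + x * cnj y * f j i + y * cnj y * f j j" for x y
    using assms(1) unfolding psd_def qform_two[OF assms(2,3), symmetric] by blast
  have "Im (f i i) = 0" "Im (f j j) = 0"
    using psd_diag(1)[OF assms(1)] assms(2,3) by (metis Im_complex_of_real)+
  then show ?thesis
    using *[of 1 1] *[of 1 "\<i>"] by (auto simp: less_eq_complex_def complex_eq_iff)
qed

lemma psd_zero_row:
  assumes "psd n f" "i < n" "j < n" "f i i = 0"
  shows "f i j = 0"
proof (rule ccontr)
  assume nz: "f i j \<noteq> 0"
  define N where "N = (cmod (f i j))\<^sup>2"
  define r where "r = Re (f j j)"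
  have fjj: "f j j = complex_of_real r" using psd_diag(1)[OF assms(1,3)] by (simp add: r_def)
  have r0: "0 \<le> r" using psd_diag(2)[OF assms(1,3)] by (simp add: r_def)
  have "N > 0" using nz by (simp add: N_def)
  \<comment> \<open>Chosen so that the form at $t f_{ij} e_i + e_j$, which is $2 t N + r$, equals $-1$.\<close>
  define t where "t = - (r + 1) / (2 * N)"
  have "0 \<le> qform n f (\<lambda>k. (if k = i then complex_of_real t * f i j else 0) + (if k = j then 1 else 0))"
    using assms(1) unfolding psd_def by blast
  also have "\<dots> = complex_of_real t * (cnj (f i j) * f i j) + complex_of_real t * (f i j * cnj (f i j)) + complex_of_real r"
    unfolding qform_two[OF assms(2,3)] using psd_hermitian[OF assms(1-3)] assms(4) fjj by (simp add: algebra_simps)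
  also have "\<dots> = complex_of_real (2 * t * N + r)"
    by (simp add: N_def complex_norm_square[symmetric] mult.commute flip: of_real_power)
  finally have "0 \<le> 2 * t * N + r" by (simp add: less_eq_complex_def)
  moreover have "2 * t * N = - (r + 1)" using \<open>N > 0\<close> by (simp add: t_def)
  ultimately show False by simp
qed

text \<open>One step of Gaussian elimination: subtracting the rank one matrix that clears the row and column
  $p$ leaves a positive semidefinite matrix, because its form at $v$ is the form of $f$ at $v + t e_p$
  for the minimizing $t$.\<close>

lemma psd_schur:
  assumes "psd n f" "p < n" "f p p \<noteq> 0"
  defines "y \<equiv> \<lambda>j. f p j / complex_of_real (sqrt (Re (f p p)))"
  shows "psd n (\<lambda>i j. f i j - outer y i j)"
  unfolding psd_def
proof
  fix v
  define a where "a = Re (f p p)"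
  have fpp: "f p p = complex_of_real a" using psd_diag(1)[OF assms(1,2)] by (simp add: a_def)
  have "a > 0" using psd_diag[OF assms(1,2)] assms(3) fpp
    by (metis a_def less_eq_real_def of_real_0)
  define S where "S = (\<Sum>j<n. f p j * v j)"
  \<comment> \<open>The minimizer of the form over the line through $v$ in direction $e_p$.\<close>
  define t where "t = - S / complex_of_real a"
  have S': "(\<Sum>i<n. f i p * cnj (v i)) = cnj S"
    unfolding S_def cnj_sum using psd_hermitian[OF assms(1,2)] by (intro sum.cong) auto
  have "0 \<le> qform n f (\<lambda>k. v k + (if k = p then t else 0))"
    using assms(1) unfolding psd_def by blast
  also have "\<dots> = qform n f v + t * cnj S + cnj t * S + t * cnj t * complex_of_real a"
    unfolding qform_shift[OF assms(2)] S' S_def[symmetric] fpp by simp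
  also have "\<dots> = qform n f v - S * cnj S / complex_of_real a"
    using \<open>a > 0\<close> by (simp add: t_def field_simps)
  also have "S * cnj S / complex_of_real a = qform n (outer y) v"
  proof -
    have "(\<Sum>j<n. y j * v j) = S / complex_of_real (sqrt a)"
      by (simp add: y_def S_def sum_divide_distrib a_def)
    then show ?thesis
      using \<open>a > 0\<close> by (simp add: qform_outer norm_divide power_divide complex_norm_square[symmetric] flip: of_real_power)
  qed
  finally show "0 \<le> qform n (\<lambda>i j. f i j - outer y i j) v"
    by (simp add: qform_diff)
qed

text \<open>Cholesky factorization: elimination of all rows writes the matrix as a sum of $n$ rank one
  matrices.\<close>

lemma psd_sum_outer:
  assumes "psd n f"
  shows "\<exists>y. \<forall>i<n. \<forall>j<n. f i j = (\<Sum>k<n. outer (y k) i j)"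
proof -
  have "m \<le> n \<Longrightarrow> \<exists>y. psd n (\<lambda>i j. f i j - (\<Sum>k<m. outer (y k) i j)) \<and>
     (\<forall>i<m. \<forall>j<n. f i j - (\<Sum>k<m. outer (y k) i j) = 0)" for m
  proof (induction m)
    case 0
    then show ?case using assms by simp
  next
    case (Suc m)
    then obtain y where y: "psd n (\<lambda>i j. f i j - (\<Sum>k<m. outer (y k) i j))"
      "\<And>i j. i < m \<Longrightarrow> j < n \<Longrightarrow> f i j - (\<Sum>k<m. outer (y k) i j) = 0" by auto
    define g where "g i j = f i j - (\<Sum>k<m. outer (y k) i j)" for i j
    have g: "psd n g" "\<And>i j. i < m \<Longrightarrow> j < n \<Longrightarrow> g i j = 0"
      using y by (auto simp: g_def[abs_def])
    have mn: "m < n" using Suc.prems by simp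
    define w where "w = (if g m m = 0 then (\<lambda>_. 0) else (\<lambda>j. g m j / complex_of_real (sqrt (Re (g m m)))))"
    have psdw: "psd n (\<lambda>i j. g i j - outer w i j)"
      using psd_schur[OF g(1) mn] g(1) by (simp add: w_def outer_def)
    have row: "g i j - outer w i j = 0" if "i < Suc m" "j < n" for i j
    proof (cases "g m m = 0")
      case True
      then show ?thesis
        using that g(2) psd_zero_row[OF g(1) mn _ True] by (auto simp: w_def outer_def less_Suc_eq)
    next
      case False
      define a where "a = Re (g m m)"
      have gmm: "g m m = complex_of_real a" using psd_diag(1)[OF g(1) mn] by (simp add: a_def)
      have "a > 0" using psd_diag[OF g(1) mn] False by (metis a_def less_eq_real_def of_real_0)
      have ow: "outer w i j = cnj (g m i) * g m j / complex_of_real a"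
        using False \<open>a > 0\<close> by (simp add: w_def outer_def a_def[symmetric] flip: of_real_mult)
      show ?thesis
      proof (cases "i = m")
        case True
        then show ?thesis using ow gmm \<open>a > 0\<close> by simp
      next
        case neq: False
        then have "i < m" using that by simp
        moreover have "g m i = cnj (g i m)" using psd_hermitian[OF g(1), of i m] mn \<open>i < m\<close> by simp
        ultimately show ?thesis using ow g(2) mn that by simp
      qed
    qed
    have eq: "f i j - (\<Sum>k<Suc m. outer ((y(m := w)) k) i j) = g i j - outer w i j" for i j
      by (simp add: g_def)
    show ?case
      by (rule exI[of _ "y(m := w)"], unfold eq) (use psdw row in auto)
  qed
  from this[of n] show ?thesis by auto
qed

lemma frob_commute: "frob n f g = frob n g f"
  unfolding frob_def by (intro sum.cong) (auto simp: algebra_simps)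

lemma frob_cong:
  assumes "\<And>i j. i < n \<Longrightarrow> j < n \<Longrightarrow> f i j = f' i j" "\<And>i j. i < n \<Longrightarrow> j < n \<Longrightarrow> g i j = g' i j"
  shows "frob n f g = frob n f' g'"
  unfolding frob_def using assms by (intro sum.cong) auto

lemma frob_add_right: "frob n f (\<lambda>i j. g i j + h i j) = frob n f g + frob n f h"
  by (simp add: frob_def sum.distrib algebra_simps)

lemma frob_diff_right: "frob n f (\<lambda>i j. g i j - h i j) = frob n f g - frob n f h"
  by (simp add: frob_def sum_subtractf algebra_simps)

lemma frob_scale_right: "frob n f (\<lambda>i j. complex_of_real c * g i j) = c * frob n f g"
  by (simp add: frob_def sum_distrib_left algebra_simps)

lemma frob_sum_right: "frob n f (\<lambda>i j. \<Sum>k\<in>K. g k i j) = (\<Sum>k\<in>K. frob n f (g k))"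
proof (cases "finite K")
  case True
  then show ?thesis by induction (simp_all add: frob_add_right, simp add: frob_def)
qed (simp add: frob_def)

lemma frob_outer: "frob n f (outer u) = Re (qform n f (\<lambda>k. cnj (u k)))"
  by (simp add: frob_def qform_def outer_def algebra_simps)

lemma frob_psd_nonneg:
  assumes "psd n f" "psd n g"
  shows "0 \<le> frob n f g"
proof -
  obtain y where y: "\<And>i j. i < n \<Longrightarrow> j < n \<Longrightarrow> g i j = (\<Sum>k<n. outer (y k) i j)"
    using psd_sum_outer[OF assms(2)] by blast
  have "frob n f g = (\<Sum>k<n. frob n f (outer (y k)))"
    unfolding frob_sum_right[symmetric] using y by (intro frob_cong) auto
  also have "\<dots> \<ge> 0"
    using assms(1) by (intro sum_nonneg) (simp add: frob_outer psd_def less_eq_complex_def)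
  finally show ?thesis .
qed

lemma psd_limit:
  assumes "\<And>k. psd n (F k)" "\<And>i j. i < n \<Longrightarrow> j < n \<Longrightarrow> (\<lambda>k. F k i j) \<longlonglongrightarrow> L i j"
  shows "psd n L"
  unfolding psd_def
proof
  fix v
  have lim: "(\<lambda>k. qform n (F k) v) \<longlonglongrightarrow> qform n L v"
    unfolding qform_def using assms(2) by (intro tendsto_intros) auto
  have pos: "0 \<le> qform n (F k) v" for k using assms(1) by (simp add: psd_def)
  have "0 \<le> Re (qform n L v)"
    by (rule LIMSEQ_le_const[OF tendsto_Re[OF lim]]) (use pos in \<open>auto simp: less_eq_complex_def\<close>)
  moreover have "(\<lambda>k. 0) \<longlonglongrightarrow> Im (qform n L v)"
    using tendsto_Im[OF lim] pos by (simp add: less_eq_complex_def)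
  then have "Im (qform n L v) = 0" by (simp add: LIMSEQ_const_iff)
  ultimately show "0 \<le> qform n L v" by (simp add: less_eq_complex_def)
qed

text \<open>The squared length of the $i$-th column of a Cholesky factor is read off from the diagonal.\<close>

lemma diag_sum_outer:
  assumes "\<And>i j. i < n \<Longrightarrow> j < n \<Longrightarrow> f i j = (\<Sum>k<m. outer (y k) i j)" "i < n"
  shows "(\<Sum>k<m. (cmod (y k i))\<^sup>2) = Re (f i i)"
proof -
  have "f i i = complex_of_real (\<Sum>k<m. (cmod (y k i))\<^sup>2)"
    unfolding assms(1)[OF assms(2,2)] of_real_sum complex_norm_square by (simp add: outer_def mult.commute)
  then show ?thesis by simp
qed

lemma psd_entry_bound:
  assumes "psd n f" "\<And>i. i < n \<Longrightarrow> Re (f i i) \<le> 1" "i < n" "j < n"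
  shows "cmod (f i j) \<le> 1"
proof -
  obtain y where y: "\<And>i j. i < n \<Longrightarrow> j < n \<Longrightarrow> f i j = (\<Sum>k<n. outer (y k) i j)"
    using psd_sum_outer[OF assms(1)] by blast
  have "cmod (f i j) \<le> (\<Sum>k<n. cmod (y k i) * cmod (y k j))"
    unfolding y[OF assms(3,4)] by (rule sum_norm_le) (simp add: outer_def norm_mult)
  also have "\<dots> \<le> (\<Sum>k<n. (cmod (y k i))\<^sup>2 / 2 + (cmod (y k j))\<^sup>2 / 2)"
  proof (rule sum_mono)
    fix k
    have "0 \<le> (cmod (y k i) - cmod (y k j))\<^sup>2" by simp
    then show "cmod (y k i) * cmod (y k j) \<le> (cmod (y k i))\<^sup>2 / 2 + (cmod (y k j))\<^sup>2 / 2"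
      by (simp add: power2_eq_square algebra_simps)
  qed
  also have "\<dots> = Re (f i i) / 2 + Re (f j j) / 2"
    using diag_sum_outer[OF y] assms(3,4) by (simp add: sum.distrib flip: sum_divide_distrib)
  also have "\<dots> \<le> 1" using assms(2)[OF assms(3)] assms(2)[OF assms(4)] by simp
  finally show ?thesis .
qed

text \<open>The entries of a matrix as a function of two indices.\<close>

definition entries :: "complex mat \<Rightarrow> nat \<Rightarrow> nat \<Rightarrow> complex" where
  "entries A i j = A $$ (i, j)"

lemma psd_mats_iff: "A \<in> psd_mats n \<longleftrightarrow> A \<in> carrier_mat n n \<and> psd n (entries A)"
proof -
  have q: "(A *\<^sub>v v) \<bullet>c v = qform n (entries A) (\<lambda>i. v $ i)" if "A \<in> carrier_mat n n" "v \<in> carrier_vec n" for v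
    using that by (auto simp: qform_def entries_def scalar_prod_def sum_distrib_right atLeast0LessThan intro!: sum.cong)
  show ?thesis
  proof
    assume A: "A \<in> psd_mats n"
    have "0 \<le> qform n (entries A) v" for v
    proof -
      have "qform n (entries A) v = qform n (entries A) (\<lambda>i. vec n v $ i)"
        by (rule qform_cong) auto
      moreover have "vec n v \<in> carrier_vec n" by simp
      ultimately show ?thesis using A q[of "vec n v"] unfolding psd_mats_def by fastforce
    qed
    then show "A \<in> carrier_mat n n \<and> psd n (entries A)"
      using A by (auto simp: psd_mats_def psd_def)
  qed (auto simp: psd_mats_def psd_def q)
qed

section \<open>The closed convex hull of the unimodular rank one matrices\<close>

lemma R_set_induct:
  assumes "R \<in> R_set n" "S \<subseteq> carrier_mat n n" "convex_mats S" "closed_mats n S"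
    "\<And>u. u \<in> carrier_vec n \<Longrightarrow> (\<forall>j<n. cmod (u $ j) = 1) \<Longrightarrow> mat n n (\<lambda>(i, j). cnj (u $ i) * u $ j) \<in> S"
  shows "R \<in> S"
  using assms unfolding R_set_def closed_convex_hull_mats_def hull_def by blast

lemma R_set_generator:
  assumes "\<And>j. j < n \<Longrightarrow> cmod (u j) = 1"
  shows "mat n n (\<lambda>(i, j). outer u i j) \<in> R_set n"
proof -
  have "mat n n (\<lambda>(i, j). outer u i j) = mat n n (\<lambda>(i, j). cnj (vec n u $ i) * vec n u $ j)"
    by (rule eq_matI) (auto simp: outer_def)
  moreover have "vec n u \<in> carrier_vec n" "\<forall>j<n. cmod (vec n u $ j) = 1" using assms by auto
  ultimately show ?thesis
    unfolding R_set_def closed_convex_hull_mats_def by (intro hull_inc) blast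
qed

lemma R_set_carrier: "R_set n \<subseteq> carrier_mat n n"
proof
  fix R assume "R \<in> R_set n"
  then show "R \<in> carrier_mat n n"
    by (rule R_set_induct) (auto simp: convex_mats_def closed_mats_def)
qed

lemma convex_mats_R_set: "convex_mats (R_set n)"
  unfolding convex_mats_def
proof (intro ballI allI impI)
  fix A B and t :: real
  assume "A \<in> R_set n" "B \<in> R_set n" "0 \<le> t" "t \<le> 1"
  then show "complex_of_real (1 - t) \<cdot>\<^sub>m A + complex_of_real t \<cdot>\<^sub>m B \<in> R_set n"
    unfolding R_set_def closed_convex_hull_mats_def hull_def convex_mats_def by blast
qed

lemma closed_mats_R_set: "closed_mats n (R_set n)"
  unfolding closed_mats_def
proof (intro ballI allI impI)
  fix A :: "nat \<Rightarrow> complex mat" and L :: "complex mat"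
  assume *: "L \<in> carrier_mat n n" "\<forall>k. A k \<in> R_set n"
    "\<forall>i<n. \<forall>j<n. (\<lambda>k. A k $$ (i, j)) \<longlonglongrightarrow> L $$ (i, j)"
  show "L \<in> R_set n"
    unfolding R_set_def closed_convex_hull_mats_def hull_def
  proof (rule InterI, clarify)
    fix S assume "S \<subseteq> carrier_mat n n" "convex_mats S" and cl: "closed_mats n S"
      and "{mat n n (\<lambda>(i, j). cnj (u $ i) * u $ j) |u. u \<in> carrier_vec n \<and> (\<forall>j<n. cmod (u $ j) = 1)} \<subseteq> S"
    then have "R_set n \<subseteq> S"
      unfolding R_set_def closed_convex_hull_mats_def by (intro hull_minimal) auto
    then show "L \<in> S" using cl * unfolding closed_mats_def by blast
  qed
qed

lemma entries_convex_comb: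
  assumes "A \<in> carrier_mat n n" "B \<in> carrier_mat n n" "i < n" "j < n"
  shows "entries (complex_of_real s \<cdot>\<^sub>m A + complex_of_real t \<cdot>\<^sub>m B) i j = complex_of_real s * entries A i j + complex_of_real t * entries B i j"
  using assms by (auto simp: entries_def)

lemma R_set_psd: 
  assumes "R \<in> R_set n"
  shows "psd n (entries R)" "\<And>i. i < n \<Longrightarrow> entries R i i = 1"
proof -
  have "R \<in> {R \<in> carrier_mat n n. psd n (entries R) \<and> (\<forall>i<n. entries R i i = 1)}" (is "R \<in> ?S")
  proof (rule R_set_induct[OF assms])
    show "convex_mats ?S"
      unfolding convex_mats_def
    proof (intro ballI allI impI)
      fix A B and t :: real
      assume A: "A \<in> ?S" and B: "B \<in> ?S" and t: "0 \<le> t" "t \<le> 1"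
      have "psd n (\<lambda>i j. complex_of_real (1 - t) * entries A i j + complex_of_real t * entries B i j)"
        using A B t by (intro psd_add psd_scale) auto
      then have "psd n (entries (complex_of_real (1 - t) \<cdot>\<^sub>m A + complex_of_real t \<cdot>\<^sub>m B))"
        using psd_cong[OF entries_convex_comb[of A n B _ _ "1 - t" t]] A B by auto
      moreover have "entries (complex_of_real (1 - t) \<cdot>\<^sub>m A + complex_of_real t \<cdot>\<^sub>m B) i i = 1" if "i < n" for i
        using entries_convex_comb[of A n B i i "1 - t" t] A B that by auto
      ultimately show "complex_of_real (1 - t) \<cdot>\<^sub>m A + complex_of_real t \<cdot>\<^sub>m B \<in> ?S"
        using A B by auto
    qed
    show "closed_mats n ?S"
      unfolding closed_mats_def
    proof (intro ballI allI impI)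
      fix A :: "nat \<Rightarrow> complex mat" and L :: "complex mat"
      assume *: "L \<in> carrier_mat n n" "\<forall>k. A k \<in> ?S"
        "\<forall>i<n. \<forall>j<n. (\<lambda>k. A k $$ (i, j)) \<longlonglongrightarrow> L $$ (i, j)"
      have "psd n (entries L)"
        by (rule psd_limit[of n "\<lambda>k. entries (A k)"]) (use * in \<open>auto simp: entries_def\<close>)
      moreover have "entries L i i = 1" if "i < n" for i
      proof -
        have "(\<lambda>k. A k $$ (i, i)) \<longlonglongrightarrow> L $$ (i, i)" using * that by blast
        moreover have "(\<lambda>k. A k $$ (i, i)) = (\<lambda>k. 1)" using * that by (auto simp: entries_def)
        ultimately show ?thesis by (simp add: LIMSEQ_const_iff entries_def)
      qed
      ultimately show "L \<in> ?S" using * by auto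
    qed
  next
    fix u :: "complex vec" assume u: "u \<in> carrier_vec n" "\<forall>j<n. cmod (u $ j) = 1"
    have "psd n (entries (mat n n (\<lambda>(i, j). cnj (u $ i) * u $ j)))"
      using psd_outer[of n "\<lambda>i. u $ i"] psd_cong[of n "outer (\<lambda>i. u $ i)" "entries (mat n n (\<lambda>(i, j). cnj (u $ i) * u $ j))"]
      by (auto simp: entries_def outer_def)
    moreover have "cnj (u $ i) * u $ i = 1" if "i < n" for i
      using u that complex_norm_square[of "u $ i"] by (simp add: mult.commute)
    ultimately show "mat n n (\<lambda>(i, j). cnj (u $ i) * u $ j) \<in> ?S"
      by (auto simp: entries_def)
  qed auto
  then show "psd n (entries R)" "\<And>i. i < n \<Longrightarrow> entries R i i = 1" by auto
qed

lemma R_set_nonempty: "\<exists>R. R \<in> R_set n"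
  using R_set_generator[of n "\<lambda>_. 1"] by auto

section \<open>Domination by multiples of matrices in the hull\<close>

text \<open>The matrix $f$ lies in $c \mathcal R_n - M_n(\mathbb C)_+$, that is, $f \le c R$ for some
  $R \in \mathcal R_n$.\<close>

definition Rdom :: "nat \<Rightarrow> real \<Rightarrow> (nat \<Rightarrow> nat \<Rightarrow> complex) \<Rightarrow> bool" where
  "Rdom n c f \<longleftrightarrow> (\<exists>R\<in>R_set n. psd n (\<lambda>i j. complex_of_real c * entries R i j - f i j))"

lemma Rdom_diff_psd:
  assumes "Rdom n c f" "psd n (\<lambda>i j. f i j - g i j)"
  shows "Rdom n c g"
proof -
  obtain R where R: "R \<in> R_set n" "psd n (\<lambda>i j. complex_of_real c * entries R i j - f i j)"
    using assms(1) by (auto simp: Rdom_def)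
  have "psd n (\<lambda>i j. (complex_of_real c * entries R i j - f i j) + (f i j - g i j))"
    by (intro psd_add R assms)
  then show ?thesis using R(1) unfolding Rdom_def by (intro bexI[of _ R]) auto
qed

lemma Rdom_cong:
  assumes "\<And>i j. i < n \<Longrightarrow> j < n \<Longrightarrow> f i j = g i j"
  shows "Rdom n c f \<longleftrightarrow> Rdom n c g"
  unfolding Rdom_def using assms by (intro bex_cong psd_cong) auto

lemma Rdom_scale:
  assumes "0 \<le> a" "Rdom n c f"
  shows "Rdom n (a * c) (\<lambda>i j. complex_of_real a * f i j)"
proof -
  obtain R where R: "R \<in> R_set n" "psd n (\<lambda>i j. complex_of_real c * entries R i j - f i j)"
    using assms(2) by (auto simp: Rdom_def)
  have "psd n (\<lambda>i j. complex_of_real a * (complex_of_real c * entries R i j - f i j))"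
    by (intro psd_scale R assms)
  then show ?thesis using R(1) unfolding Rdom_def by (intro bexI[of _ R]) (auto simp: algebra_simps)
qed

lemma Rdom_add:
  assumes "0 \<le> c" "0 \<le> d" "Rdom n c f" "Rdom n d g"
  shows "Rdom n (c + d) (\<lambda>i j. f i j + g i j)"
proof -
  obtain R where R: "R \<in> R_set n" "psd n (\<lambda>i j. complex_of_real c * entries R i j - f i j)"
    using assms(3) by (auto simp: Rdom_def)
  obtain S where S: "S \<in> R_set n" "psd n (\<lambda>i j. complex_of_real d * entries S i j - g i j)"
    using assms(4) by (auto simp: Rdom_def)
  have carr: "R \<in> carrier_mat n n" "S \<in> carrier_mat n n" using R S R_set_carrier by auto
  have sum: "psd n (\<lambda>i j. (complex_of_real c * entries R i j - f i j) + (complex_of_real d * entries S i j - g i j))"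
    by (intro psd_add R S)
  \<comment> \<open>If $c = d = 0$, then $t = 0$ by the convention on division by zero, and any matrix in the hull serves.\<close>
  define t where "t = d / (c + d)"
  define T where "T = complex_of_real (1 - t) \<cdot>\<^sub>m R + complex_of_real t \<cdot>\<^sub>m S"
  have t: "0 \<le> t" "t \<le> 1" using assms by (auto simp: t_def divide_simps)
  have T: "T \<in> R_set n"
    using convex_mats_R_set[of n] R S t unfolding convex_mats_def T_def by blast
  have td: "(c + d) * t = d" using assms by (auto simp: t_def)
  have "(c + d) * (1 - t) = c" using td by (simp add: algebra_simps)
  have "complex_of_real (c + d) * entries T i j - (f i j + g i j) =
    (complex_of_real c * entries R i j - f i j) + (complex_of_real d * entries S i j - g i j)" if "i < n" "j < n" for i j
  proof -
    have "complex_of_real (c + d) * entries T i j = complex_of_real ((c + d) * (1 - t)) * entries R i j + complex_of_real ((c + d) * t) * entries S i j"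
      unfolding T_def entries_convex_comb[OF carr that] by (simp only: of_real_mult distrib_left mult.assoc)
    then show ?thesis unfolding td \<open>(c + d) * (1 - t) = c\<close> by simp
  qed
  then have "psd n (\<lambda>i j. complex_of_real (c + d) * entries T i j - (f i j + g i j))"
    using sum by (subst psd_cong) auto
  then show ?thesis using T unfolding Rdom_def by blast
qed

lemma Rdom_zero: "Rdom n 0 (\<lambda>i j. 0)"
  using R_set_nonempty psd_zero by (simp add: Rdom_def)

lemma Rdom_mono:
  assumes "Rdom n c f" "c \<le> d"
  shows "Rdom n d f"
proof -
  obtain R where R: "R \<in> R_set n" "psd n (\<lambda>i j. complex_of_real c * entries R i j - f i j)"
    using assms(1) by (auto simp: Rdom_def)
  have "psd n (\<lambda>i j. complex_of_real (d - c) * entries R i j + (complex_of_real c * entries R i j - f i j))"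
    using assms(2) by (intro psd_add psd_scale R R_set_psd(1)) auto
  then show ?thesis using R(1) unfolding Rdom_def by (intro bexI[of _ R]) (auto simp: algebra_simps)
qed

lemma Rdom_sum:
  assumes "finite K" "\<And>k. k \<in> K \<Longrightarrow> Rdom n c (F k)" "0 \<le> c"
  shows "Rdom n (c * card K) (\<lambda>i j. \<Sum>k\<in>K. F k i j)"
  using assms(1,2)
proof induction
  case (insert x K)
  then have "Rdom n (c + c * card K) (\<lambda>i j. F x i j + (\<Sum>k\<in>K. F k i j))"
    using assms(3) by (intro Rdom_add) auto
  then show ?case using insert.hyps by (simp add: algebra_simps)
qed (simp add: Rdom_zero)

lemma Rdom_sum_list:
  assumes "\<And>x. x \<in> set xs \<Longrightarrow> Rdom n c (F x)" "0 \<le> c"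
  shows "Rdom n (c * length xs) (\<lambda>i j. \<Sum>x\<leftarrow>xs. F x i j)"
  using assms(1)
proof (induction xs)
  case (Cons x xs)
  then have "Rdom n (c + c * length xs) (\<lambda>i j. F x i j + (\<Sum>k\<leftarrow>xs. F k i j))"
    using assms(2) by (intro Rdom_add) auto
  then show ?case by (simp add: algebra_simps)
qed (simp add: Rdom_zero)

lemma mean_unimodular:
  assumes "cmod z \<le> 1"
  obtains w w' where "cmod w = 1" "cmod w' = 1" "z = (w + w') / 2"
proof
  define \<phi> where "\<phi> = arccos (cmod z)"
  have c: "cos \<phi> = cmod z" using assms by (simp add: \<phi>_def cos_arccos order_trans[OF _ norm_ge_zero])
  show "cmod (cis (Arg z + \<phi>)) = 1" "cmod (cis (Arg z - \<phi>)) = 1" by auto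
  have "cis (Arg z + \<phi>) + cis (Arg z - \<phi>) = cis (Arg z) * (cis \<phi> + cis (- \<phi>))"
    by (simp add: cis_mult algebra_simps)
  also have "cis \<phi> + cis (- \<phi>) = complex_of_real (2 * cmod z)"
    using c by (simp add: complex_eq_iff)
  finally have "cis (Arg z + \<phi>) + cis (Arg z - \<phi>) = 2 * rcis (cmod z) (Arg z)"
    by (simp add: rcis_def)
  then show "z = (cis (Arg z + \<phi>) + cis (Arg z - \<phi>)) / 2" by (simp add: rcis_cmod_Arg)
qed

text \<open>A vector in the closed unit polydisc is averaged to unimodular ones, one coordinate at a time: if
  $u = (a + b)/2$, then $\frac12 \bar a a^T + \frac12 \bar b b^T - \bar u u^T$ is the rank one matrix of $(a - b)/2$.\<close>

lemma Rdom_outer: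
  assumes "\<And>j. j < n \<Longrightarrow> cmod (u j) \<le> 1"
  shows "Rdom n 1 (outer u)"
proof -
  have "(\<forall>j<n. cmod (u j) \<le> 1) \<Longrightarrow> (\<forall>j<n. m \<le> j \<longrightarrow> cmod (u j) = 1) \<Longrightarrow> Rdom n 1 (outer u)" for m u
  proof (induction m arbitrary: u)
    case 0
    have "psd n (\<lambda>i j. complex_of_real 1 * entries (mat n n (\<lambda>(i, j). outer u i j)) i j - outer u i j)"
      by (subst psd_cong[of n _ "\<lambda>i j. 0"]) (auto simp: entries_def psd_zero)
    then show ?case unfolding Rdom_def using R_set_generator[of n u] 0 by blast
  next
    case (Suc m)
    show ?case
    proof (cases "m < n")
      case False
      then show ?thesis using Suc by auto
    next
      case True
      obtain w w' where w: "cmod w = 1" "cmod w' = 1" "u m = (w + w') / 2"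
        using mean_unimodular Suc.prems(1) True by blast
      define a where "a = u(m := w)"
      define b where "b = u(m := w')"
      have "Rdom n 1 (outer a)" "Rdom n 1 (outer b)"
        using Suc.prems w by (auto intro!: Suc.IH simp: a_def b_def le_eq_less_or_eq)
      then have "Rdom n (1/2 * 1 + 1/2 * 1) (\<lambda>i j. complex_of_real (1/2) * outer a i j + complex_of_real (1/2) * outer b i j)"
        by (intro Rdom_add Rdom_scale) auto
      moreover have "psd n (\<lambda>i j. (complex_of_real (1/2) * outer a i j + complex_of_real (1/2) * outer b i j) - outer u i j)"
      proof -
        have "(complex_of_real (1/2) * outer a i j + complex_of_real (1/2) * outer b i j) - outer u i j
           = outer (\<lambda>k. (a k - b k) / 2) i j" for i j
        proof -
          have u: "u = (\<lambda>k. (a k + b k) / 2)" using w by (auto simp: a_def b_def)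
          show ?thesis unfolding u by (simp add: outer_def field_simps)
        qed
        then show ?thesis using psd_outer by presburger
      qed
      ultimately show ?thesis using Rdom_diff_psd by fastforce
    qed
  qed
  \<comment> \<open>For $m = n$ no coordinate has to be unimodular.\<close>
  from this[of u n] show ?thesis using assms by auto
qed

section \<open>A uniform domination constant\<close>

lemma parallelogram_fourth:
  fixes z w :: complex
  shows "(cmod (z + w)) ^ 4 + (cmod (z - w)) ^ 4
    \<le> 2 * (cmod z) ^ 4 + 12 * (cmod z)\<^sup>2 * (cmod w)\<^sup>2 + 2 * (cmod w) ^ 4"
proof -
  define a where "a = (cmod z)\<^sup>2"
  define b where "b = (cmod w)\<^sup>2"
  define r where "r = Re (z * cnj w)"
  have "r\<^sup>2 \<le> (cmod (z * cnj w))\<^sup>2"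
    unfolding r_def by (metis abs_Re_le_cmod abs_ge_zero power2_abs power_mono)
  then have r: "r\<^sup>2 \<le> a * b" by (simp add: a_def b_def norm_mult power_mult_distrib)
  have p: "(cmod (z + w))\<^sup>2 = a + b + 2 * r"
    unfolding a_def b_def r_def cmod_power2 by (simp add: power2_eq_square algebra_simps)
  have m: "(cmod (z - w))\<^sup>2 = a + b - 2 * r"
    unfolding a_def b_def r_def cmod_power2 by (simp add: power2_eq_square algebra_simps)
  have four: "x ^ 4 = (x\<^sup>2)\<^sup>2" for x :: real by simp
  have "(a + b + 2 * r)\<^sup>2 + (a + b - 2 * r)\<^sup>2 = 2 * a\<^sup>2 + 4 * a * b + 2 * b\<^sup>2 + 8 * r\<^sup>2"
    by (simp add: power2_eq_square algebra_simps)
  then show ?thesis unfolding four p m using r by (simp add: a_def b_def mult.commute)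
qed

text \<open>The witness is the list of all combinations $\sum_k \pm y_k$, so averages over it are expectations
  over independent random signs. The second moments are those of a sum of independent vectors, and the
  fourth moment of each coordinate is at most three times the square of its variance.\<close>

lemma random_signs:
  fixes y :: "nat \<Rightarrow> nat \<Rightarrow> complex" and m :: nat
  shows "\<exists>gs. gs \<noteq> [] \<and>
     (\<forall>i j. (\<Sum>g\<leftarrow>gs. outer g i j) = of_nat (length gs) * (\<Sum>k<m. outer (y k) i j)) \<and>
     (\<forall>i. (\<Sum>g\<leftarrow>gs. (cmod (g i)) ^ 4) \<le> 3 * real (length gs) * (\<Sum>k<m. (cmod (y k i))\<^sup>2)\<^sup>2)"
proof (induction m)
  case 0
  show ?case by (rule exI[of _ "[\<lambda>_. 0]"]) (simp add: outer_def)
next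
  case (Suc m)
  then obtain gs where gs: "gs \<noteq> []"
    "\<And>i j. (\<Sum>g\<leftarrow>gs. outer g i j) = of_nat (length gs) * (\<Sum>k<m. outer (y k) i j)"
    "\<And>i. (\<Sum>g\<leftarrow>gs. (cmod (g i)) ^ 4) \<le> 3 * real (length gs) * (\<Sum>k<m. (cmod (y k i))\<^sup>2)\<^sup>2"
    by blast
  define hs where "hs = map (\<lambda>g i. g i + y m i) gs @ map (\<lambda>g i. g i - y m i) gs"
  have len: "length hs = 2 * length gs" by (simp add: hs_def)
  have eq1: "(\<Sum>h\<leftarrow>hs. outer h i j) = (\<Sum>g\<leftarrow>gs. 2 * outer g i j + 2 * outer (y m) i j)" for i j
    unfolding hs_def by (induction gs) (simp_all add: outer_def algebra_simps)
  have "(\<Sum>h\<leftarrow>hs. outer h i j) = of_nat (length hs) * (\<Sum>k<Suc m. outer (y k) i j)" for i j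
    unfolding eq1 sum_list_addf sum_list_const_mult gs(2) len
    by (simp add: sum_list_triv algebra_simps)
  moreover have "(\<Sum>h\<leftarrow>hs. (cmod (h i)) ^ 4) \<le> 3 * real (length hs) * (\<Sum>k<Suc m. (cmod (y k i))\<^sup>2)\<^sup>2" for i
  proof -
    define L where "L = real (length gs)"
    define V where "V = (\<Sum>k<m. (cmod (y k i))\<^sup>2)"
    define w where "w = (cmod (y m i))\<^sup>2"
    have o: "outer g i i = complex_of_real ((cmod (g i))\<^sup>2)" for g
      by (simp add: outer_def complex_norm_square mult.commute del: of_real_power)
    have "(\<Sum>g\<leftarrow>gs. complex_of_real ((cmod (g i))\<^sup>2)) = complex_of_real (\<Sum>g\<leftarrow>gs. (cmod (g i))\<^sup>2)"
      by (induction gs) auto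
    then have "complex_of_real (\<Sum>g\<leftarrow>gs. (cmod (g i))\<^sup>2) = complex_of_real (L * V)"
      using gs(2)[of i i] unfolding o L_def V_def by simp
    then have second: "(\<Sum>g\<leftarrow>gs. (cmod (g i))\<^sup>2) = L * V" by (simp only: of_real_eq_iff)
    have "(\<Sum>h\<leftarrow>hs. (cmod (h i)) ^ 4) = (\<Sum>g\<leftarrow>gs. (cmod (g i + y m i)) ^ 4 + (cmod (g i - y m i)) ^ 4)"
      unfolding hs_def by (induction gs) simp_all
    also have "\<dots> \<le> (\<Sum>g\<leftarrow>gs. 2 * (cmod (g i)) ^ 4 + 12 * w * (cmod (g i))\<^sup>2 + 2 * w\<^sup>2)"
      by (rule sum_list_mono) (use parallelogram_fourth in \<open>auto simp: w_def algebra_simps\<close>)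
    also have "\<dots> = 2 * (\<Sum>g\<leftarrow>gs. (cmod (g i)) ^ 4) + 12 * w * (L * V) + 2 * w\<^sup>2 * L"
      unfolding sum_list_addf sum_list_const_mult second by (simp add: sum_list_triv L_def)
    also have "\<dots> \<le> 2 * (3 * L * V\<^sup>2) + 12 * w * (L * V) + 6 * w\<^sup>2 * L"
    proof -
      have "0 \<le> w\<^sup>2 * L" by (simp add: L_def)
      then show ?thesis using gs(3)[of i] unfolding V_def[symmetric] L_def[symmetric] by linarith
    qed
    also have "\<dots> = 3 * real (length hs) * (V + w)\<^sup>2"
      by (simp add: len L_def power2_eq_square algebra_simps)
    finally show ?thesis by (simp add: V_def w_def)
  qed
  moreover have "hs \<noteq> []" using gs(1) by (simp add: hs_def)
  ultimately show ?case by blast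
qed

text \<open>Split each random vector as $g = a + b$, where $a$ keeps the coordinates with $|g_i|^2 \le 12$.
  Then $f \le 2\, \mathrm{E}\, \bar a a^T + 2\, \mathrm{E}\, \bar b b^T$. The first term is at most $24 R$. The
  second is $\frac12 h$ with $h = 4\, \mathrm{E}\, \bar b b^T$, whose diagonal is at most
  $4 \cdot \mathrm{E} |g_i|^4 / 12 \le 1$, so the hypothesis applies to $h$.\<close>

lemma Rdom_truncation_step:
  assumes c: "0 \<le> c"
    and IH: "\<And>f. psd n f \<Longrightarrow> (\<And>i. i < n \<Longrightarrow> Re (f i i) \<le> 1) \<Longrightarrow> Rdom n c f"
    and f: "psd n f" "\<And>i. i < n \<Longrightarrow> Re (f i i) \<le> 1"
  shows "Rdom n (24 + c / 2) f"
proof -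
  obtain y where y: "\<And>i j. i < n \<Longrightarrow> j < n \<Longrightarrow> f i j = (\<Sum>k<n. outer (y k) i j)"
    using psd_sum_outer[OF f(1)] by blast
  obtain gs where gs: "gs \<noteq> []"
    "\<And>i j. (\<Sum>g\<leftarrow>gs. outer g i j) = of_nat (length gs) * (\<Sum>k<n. outer (y k) i j)"
    "\<And>i. (\<Sum>g\<leftarrow>gs. (cmod (g i)) ^ 4) \<le> 3 * real (length gs) * (\<Sum>k<n. (cmod (y k i))\<^sup>2)\<^sup>2"
    using random_signs[where y = y and m = n] by blast
  define L where "L = real (length gs)"
  have L: "L > 0" using gs(1) by (simp add: L_def)
  define a where "a g i = (if (cmod (g i))\<^sup>2 \<le> 12 then g i else 0)" for g :: "nat \<Rightarrow> complex" and i
  define b where "b g i = g i - a g i" for g i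
  define A where "A i j = (\<Sum>g\<leftarrow>gs. outer (a g) i j)" for i j
  define B where "B i j = (\<Sum>g\<leftarrow>gs. outer (b g) i j)" for i j
  have a_bound: "Rdom n 12 (outer (a g))" for g
  proof -
    have "cmod (a g j / sqrt 12) \<le> 1" for j
    proof -
      have "cmod (a g j) \<le> sqrt 12" by (rule real_le_rsqrt) (simp add: a_def)
      then show ?thesis by (simp add: norm_divide)
    qed
    then have "Rdom n (12 * 1) (\<lambda>i j. complex_of_real 12 * outer (\<lambda>j. a g j / sqrt 12) i j)"
      by (intro Rdom_scale Rdom_outer) auto
    moreover have "complex_of_real 12 * outer (\<lambda>j. a g j / sqrt 12) i j = outer (a g) i j" for i j
      by (simp add: outer_def flip: of_real_mult)
    ultimately show ?thesis by (simp only: mult_1_right)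
  qed
  have "Rdom n (12 * L) A" unfolding A_def L_def by (intro Rdom_sum_list a_bound) simp
  then have RA: "Rdom n (2 / L * (12 * L)) (\<lambda>i j. complex_of_real (2 / L) * A i j)"
    using L by (intro Rdom_scale) auto
  have b_bound: "(cmod (b g i))\<^sup>2 \<le> (cmod (g i)) ^ 4 / 12" for g i
  proof (cases "(cmod (g i))\<^sup>2 \<le> 12")
    case False
    have "12 * (cmod (g i))\<^sup>2 \<le> (cmod (g i))\<^sup>2 * (cmod (g i))\<^sup>2"
      using False by (intro mult_right_mono) auto
    then show ?thesis using False by (simp add: a_def b_def power4_eq_xxxx power2_eq_square mult.assoc)
  qed (simp add: a_def b_def)
  have "Rdom n c (\<lambda>i j. complex_of_real (4 / L) * B i j)"
  proof (rule IH)
    show "psd n (\<lambda>i j. complex_of_real (4 / L) * B i j)"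
      unfolding B_def using L by (intro psd_scale psd_sum_list psd_outer) auto
  next
    fix i assume i: "i < n"
    have "B i i = complex_of_real (\<Sum>g\<leftarrow>gs. (cmod (b g i))\<^sup>2)"
      unfolding B_def by (induction gs)
        (simp_all add: outer_def complex_norm_square mult.commute del: of_real_power)
    moreover have "(\<Sum>g\<leftarrow>gs. (cmod (b g i))\<^sup>2) \<le> L / 4"
    proof -
      have "(\<Sum>g\<leftarrow>gs. (cmod (b g i))\<^sup>2) \<le> (\<Sum>g\<leftarrow>gs. 1 / 12 * (cmod (g i)) ^ 4)"
        by (rule sum_list_mono) (use b_bound in auto)
      also have "\<dots> \<le> 1 / 12 * (3 * L * (Re (f i i))\<^sup>2)"
        unfolding sum_list_const_mult using gs(3)[of i] diag_sum_outer[OF y i] by (simp add: L_def)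
      also have "\<dots> \<le> 1 / 12 * (3 * L * 1)"
        using L f(2)[OF i] psd_diag(2)[OF f(1) i]
        by (intro mult_left_mono) (auto simp: power_le_one)
      finally show ?thesis by simp
    qed
    ultimately show "Re (complex_of_real (4 / L) * B i i) \<le> 1"
      using L by (simp add: field_simps)
  qed
  then have RB: "Rdom n (1 / 2 * c) (\<lambda>i j. complex_of_real (1 / 2) * (complex_of_real (4 / L) * B i j))"
    by (intro Rdom_scale) auto
  have "Rdom n (2 / L * (12 * L) + 1 / 2 * c)
      (\<lambda>i j. complex_of_real (2 / L) * A i j + complex_of_real (1 / 2) * (complex_of_real (4 / L) * B i j))"
    using c L by (intro Rdom_add RA RB) auto
  then have "Rdom n (24 + c / 2) (\<lambda>i j. complex_of_real (2 / L) * A i j + complex_of_real (2 / L) * B i j)"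
    using L by simp
  moreover have "psd n (\<lambda>i j. (complex_of_real (2 / L) * A i j + complex_of_real (2 / L) * B i j) - f i j)"
  proof -
    have "complex_of_real (1 / L) * (\<Sum>g\<leftarrow>gs. outer (\<lambda>k. a g k - b g k) i j) =
       (complex_of_real (2 / L) * A i j + complex_of_real (2 / L) * B i j) - f i j"
      if "i < n" "j < n" for i j
    proof -
      have "f i j = complex_of_real (1 / L) * (\<Sum>g\<leftarrow>gs. outer g i j)"
        using gs(1,2) y[OF that] by (simp add: L_def)
      also have "(\<Sum>g\<leftarrow>gs. outer g i j) = 2 * A i j + 2 * B i j - (\<Sum>g\<leftarrow>gs. outer (\<lambda>k. a g k - b g k) i j)"
        unfolding A_def B_def by (induction gs) (simp_all add: outer_def b_def algebra_simps)
      finally show ?thesis using L by (simp add: field_simps)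
    qed
    moreover have "psd n (\<lambda>i j. complex_of_real (1 / L) * (\<Sum>g\<leftarrow>gs. outer (\<lambda>k. a g k - b g k) i j))"
      using L by (intro psd_scale psd_sum_list psd_outer) auto
    ultimately show ?thesis by (subst (asm) psd_cong) auto
  qed
  ultimately show ?thesis by (rule Rdom_diff_psd)
qed

lemma Rdom_trivial_bound:
  assumes "psd n f" "\<And>i. i < n \<Longrightarrow> Re (f i i) \<le> 1"
  shows "Rdom n (real n) f"
proof -
  obtain y where y: "\<And>i j. i < n \<Longrightarrow> j < n \<Longrightarrow> f i j = (\<Sum>k<n. outer (y k) i j)"
    using psd_sum_outer[OF assms(1)] by blast
  have "cmod (y k i) \<le> 1" if "k < n" "i < n" for k i
  proof -
    have "(cmod (y k i))\<^sup>2 \<le> (\<Sum>k<n. (cmod (y k i))\<^sup>2)"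
      using that by (intro member_le_sum) auto
    also have "\<dots> \<le> 1" using diag_sum_outer[OF y that(2)] assms(2)[OF that(2)] by simp
    finally show ?thesis by (simp add: abs_square_le_1)
  qed
  then have "Rdom n (1 * real (card {..<n})) (\<lambda>i j. \<Sum>k<n. outer (y k) i j)"
    by (intro Rdom_sum Rdom_outer) auto
  then show ?thesis using Rdom_cong[of n f "\<lambda>i j. \<Sum>k<n. outer (y k) i j"] y by simp
qed

lemma Rdom_uniform_bound:
  assumes "psd n f" "\<And>i. i < n \<Longrightarrow> Re (f i i) \<le> 1"
  shows "Rdom n 49 f"
proof -
  have "psd n f \<Longrightarrow> (\<And>i. i < n \<Longrightarrow> Re (f i i) \<le> 1) \<Longrightarrow> Rdom n (48 + real n / 2 ^ N) f" for N f
  proof (induction N arbitrary: f)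
    case 0
    then show ?case using Rdom_trivial_bound Rdom_mono[of n "real n" f "48 + real n"] by simp
  next
    case (Suc N)
    have "Rdom n (24 + (48 + real n / 2 ^ N) / 2) f"
      using Suc by (intro Rdom_truncation_step) auto
    then show ?case by (simp add: field_simps)
  qed
  \<comment> \<open>Already $N = n$ makes the remainder $n / 2^N$ at most $1$.\<close>
  from this[of f n] have "Rdom n (48 + real n / 2 ^ n) f" using assms by blast
  moreover have "real n \<le> 2 ^ n" using less_exp[of n] by (metis less_imp_le of_nat_le_numeral_power_cancel_iff)
  ultimately show ?thesis by (elim Rdom_mono) simp
qed

section \<open>Separation from a compact convex set minus the positive cone\<close>

lemma bounded_complex_subseq:
  fixes X :: "nat \<Rightarrow> complex"
  assumes "Bseq X"
  shows "\<exists>r l. strict_mono r \<and> (\<lambda>k. X (r k)) \<longlonglongrightarrow> l"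
proof -
  have *: "\<exists>r. strict_mono r \<and> convergent (\<lambda>k. Z (r k))" if "Bseq Z" for Z :: "nat \<Rightarrow> real"
  proof -
    obtain r where r: "strict_mono r" "monoseq (\<lambda>k. Z (r k))" using seq_monosub[of Z] by blast
    have "Bseq (\<lambda>k. Z (r k))" using Bseq_subseq[OF that, of r] by simp
    then show ?thesis using r Bseq_monoseq_convergent by blast
  qed
  obtain K where K: "\<And>k. cmod (X k) \<le> K" using assms by (auto simp: Bseq_def)
  have "Bseq (\<lambda>k. Re (X k))"
    by (rule BseqI'[of _ K]) (metis K abs_Re_le_cmod order_trans real_norm_def)
  then obtain r where r: "strict_mono r" "convergent (\<lambda>k. Re (X (r k)))" using * by blast
  have "Bseq (\<lambda>k. Im (X (r k)))"
    by (rule BseqI'[of _ K]) (metis K abs_Im_le_cmod order_trans real_norm_def)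
  from *[OF this] obtain s where s: "strict_mono s" "convergent (\<lambda>k. Im (X (r (s k))))" by blast
  obtain a where "(\<lambda>k. Re (X (r k))) \<longlonglongrightarrow> a" using r(2) by (auto simp: convergent_def)
  then have a: "(\<lambda>k. Re (X (r (s k)))) \<longlonglongrightarrow> a" using LIMSEQ_subseq_LIMSEQ[OF _ s(1)] by (force simp: o_def)
  obtain b where b: "(\<lambda>k. Im (X (r (s k)))) \<longlonglongrightarrow> b" using s(2) by (auto simp: convergent_def)
  have "(\<lambda>k. X ((r \<circ> s) k)) \<longlonglongrightarrow> Complex a b"
    using tendsto_Complex[OF a b] by simp
  then show ?thesis using strict_mono_o[OF r(1) s(1)] by blast
qed

lemma bounded_family_subseq:
  fixes F :: "nat \<Rightarrow> 'a \<Rightarrow> complex"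
  assumes "finite I" "\<And>i. i \<in> I \<Longrightarrow> Bseq (\<lambda>k. F k i)"
  shows "\<exists>r l. strict_mono r \<and> (\<forall>i\<in>I. (\<lambda>k. F (r k) i) \<longlonglongrightarrow> l i)"
  using assms
proof induction
  case empty
  then show ?case using strict_mono_id by auto
next
  case (insert x I)
  then obtain r l where r: "strict_mono r" "\<And>i. i \<in> I \<Longrightarrow> (\<lambda>k. F (r k) i) \<longlonglongrightarrow> l i" by blast
  have "Bseq (\<lambda>k. F (r k) x)" using Bseq_subseq[of "\<lambda>k. F k x" r] insert.prems by simp
  from bounded_complex_subseq[OF this] obtain s c where s: "strict_mono s" "(\<lambda>k. F (r (s k)) x) \<longlonglongrightarrow> c" by blast
  have "(\<lambda>k. F (r (s k)) i) \<longlonglongrightarrow> l i" if "i \<in> I" for i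
    using LIMSEQ_subseq_LIMSEQ[OF r(2)[OF that] s(1)] by (simp add: o_def)
  then have "\<forall>i\<in>insert x I. (\<lambda>k. F ((r \<circ> s) k) i) \<longlonglongrightarrow> (l(x := c)) i"
    using s(2) insert.hyps by auto
  then show ?case using strict_mono_o[OF r(1) s(1)] by blast
qed

lemma bounded_entries_subseq:
  fixes F :: "nat \<Rightarrow> nat \<Rightarrow> nat \<Rightarrow> complex"
  assumes "\<And>i j. i < n \<Longrightarrow> j < n \<Longrightarrow> Bseq (\<lambda>k. F k i j)"
  shows "\<exists>r L. strict_mono r \<and> (\<forall>i<n. \<forall>j<n. (\<lambda>k. F (r k) i j) \<longlonglongrightarrow> L i j)"
proof -
  have "\<exists>r l. strict_mono r \<and> (\<forall>p\<in>{..<n} \<times> {..<n}. (\<lambda>k. F (r k) (fst p) (snd p)) \<longlonglongrightarrow> l p)"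
    using assms by (intro bounded_family_subseq[where F = "\<lambda>k p. F k (fst p) (snd p)"]) auto
  then obtain r l where "strict_mono r" "\<forall>p\<in>{..<n} \<times> {..<n}. (\<lambda>k. F (r k) (fst p) (snd p)) \<longlonglongrightarrow> l p"
    by blast
  then show ?thesis by (intro exI[of _ r] exI[of _ "\<lambda>i j. l (i, j)"]) auto
qed

lemma frob_self: "frob n f f = (\<Sum>i<n. \<Sum>j<n. (cmod (f i j))\<^sup>2)"
  unfolding frob_def by (intro sum.cong refl) (simp add: cmod_power2 flip: power2_eq_square)

lemma entry_le_frob:
  assumes "i < n" "j < n"
  shows "(cmod (f i j))\<^sup>2 \<le> frob n f f"
proof -
  have "(cmod (f i j))\<^sup>2 \<le> (\<Sum>j<n. (cmod (f i j))\<^sup>2)"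
    using assms by (intro member_le_sum) auto
  also have "\<dots> \<le> frob n f f"
    unfolding frob_self using assms by (intro member_le_sum[of i _ "\<lambda>i. \<Sum>j<n. (cmod (f i j))\<^sup>2"] sum_nonneg) auto
  finally show ?thesis .
qed

lemma tendsto_frob:
  assumes "\<And>i j. i < n \<Longrightarrow> j < n \<Longrightarrow> (\<lambda>k. F k i j) \<longlonglongrightarrow> f i j"
    "\<And>i j. i < n \<Longrightarrow> j < n \<Longrightarrow> (\<lambda>k. G k i j) \<longlonglongrightarrow> g i j"
  shows "(\<lambda>k. frob n (F k) (G k)) \<longlonglongrightarrow> frob n f g"
  unfolding frob_def using assms by (intro tendsto_intros) auto

lemma quadratic_nonneg_slope:
  fixes b c :: real
  assumes "\<And>t. 0 < t \<Longrightarrow> t \<le> 1 \<Longrightarrow> 0 \<le> 2 * t * b + t\<^sup>2 * c"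
  shows "0 \<le> b"
proof (rule ccontr)
  assume "\<not> 0 \<le> b"
  define t where "t = min 1 (- b / (\<bar>c\<bar> + 1))"
  have t: "0 < t" "t \<le> 1" using \<open>\<not> 0 \<le> b\<close> by (auto simp: t_def divide_neg_pos)
  have "t * (\<bar>c\<bar> + 1) \<le> - b" 
  proof -
    have "t \<le> - b / (\<bar>c\<bar> + 1)" by (simp add: t_def)
    then show ?thesis using pos_le_divide_eq[of "\<bar>c\<bar> + 1" t "- b"] by (simp only: abs_add_one_gt_zero add.commute)
  qed
  moreover have "0 \<le> t * (2 * b + t * c)"
    using assms[OF t] by (simp add: power2_eq_square algebra_simps)
  then have "0 \<le> 2 * b + t * c" using t by (simp add: zero_le_mult_iff)
  moreover have "t * c \<le> t * \<bar>c\<bar>" using t by (intro mult_left_mono) auto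
  ultimately show False using t \<open>\<not> 0 \<le> b\<close> by (simp add: algebra_simps)
qed

text \<open>Here $H$ is the element $X - Y_0 + P_0$ of least Frobenius norm among all $X - Y + P$ with $Y \in C$
  and $P$ positive semidefinite. Compactness of $C$ makes the minimum attained. Minimality gives
  $\langle H, X - Y + P\rangle \ge \delta = \langle H, H\rangle$ for all such $Y$, $P$; taking large multiples of rank one
  matrices for $P$ shows that $H$ is positive semidefinite, and $P = 0$ gives the separation.\<close>

lemma psd_separation:
  fixes C :: "(nat \<Rightarrow> nat \<Rightarrow> complex) set"
  assumes convex: "\<And>Y Y' t. Y \<in> C \<Longrightarrow> Y' \<in> C \<Longrightarrow> 0 \<le> t \<Longrightarrow> t \<le> 1 \<Longrightarrow>
      \<exists>Z\<in>C. \<forall>i<n. \<forall>j<n. Z i j = complex_of_real (1 - t) * Y i j + complex_of_real t * Y' i j"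
    and compact: "\<And>S :: nat \<Rightarrow> nat \<Rightarrow> nat \<Rightarrow> complex. (\<And>k. S k \<in> C) \<Longrightarrow>
      \<exists>Y\<in>C. \<exists>r. strict_mono r \<and> (\<forall>i<n. \<forall>j<n. (\<lambda>k. S (r k) i j) \<longlonglongrightarrow> Y i j)"
    and nonempty: "C \<noteq> {}"
    and C_herm: "\<And>Y i j. Y \<in> C \<Longrightarrow> i < n \<Longrightarrow> j < n \<Longrightarrow> Y j i = cnj (Y i j)"
    and X_herm: "\<And>i j. i < n \<Longrightarrow> j < n \<Longrightarrow> X j i = cnj (X i j)"
    and notin: "\<And>Y. Y \<in> C \<Longrightarrow> \<not> psd n (\<lambda>i j. Y i j - X i j)"
  shows "\<exists>H \<delta>. psd n H \<and> 0 < \<delta> \<and> (\<forall>Y\<in>C. frob n H Y + \<delta> \<le> frob n H X)"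
proof -
  define Z where "Z Y P i j = X i j - Y i j + P i j" for Y P :: "nat \<Rightarrow> nat \<Rightarrow> complex" and i j
  define N where "N = {frob n (Z Y P) (Z Y P) | Y P. Y \<in> C \<and> psd n P}"
  have N_ne: "N \<noteq> {}" using nonempty psd_zero[of n] unfolding N_def by blast
  have N_bdd: "bdd_below N"
    by (rule bdd_belowI[of _ 0]) (auto simp: N_def frob_self intro!: sum_nonneg)
  have "\<exists>Y P. Y \<in> C \<and> psd n P \<and> frob n (Z Y P) (Z Y P) < Inf N + 1 / real (Suc k)" for k
  proof -
    have "Inf N < Inf N + 1 / real (Suc k)" by simp
    then obtain x where "x \<in> N" "x < Inf N + 1 / real (Suc k)"
      using cInf_lessD[OF N_ne] by blast
    then show ?thesis by (auto simp: N_def)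
  qed
  then obtain Y P where YP: "\<And>k. Y k \<in> C" "\<And>k. psd n (P k)"
    "\<And>k. frob n (Z (Y k) (P k)) (Z (Y k) (P k)) < Inf N + 1 / real (Suc k)"
    by metis
  obtain Y0 r where Y0: "Y0 \<in> C" and r: "strict_mono r"
    and Ylim: "\<And>i j. i < n \<Longrightarrow> j < n \<Longrightarrow> (\<lambda>k. Y (r k) i j) \<longlonglongrightarrow> Y0 i j"
    using compact[of Y] YP(1) by blast
  have Pbdd: "Bseq (\<lambda>k. P (r k) i j)" if ij: "i < n" "j < n" for i j
  proof -
    have "Bseq (\<lambda>k. Y (r k) i j)"
      using Ylim[OF ij] convergentI convergent_imp_Bseq by blast
    then obtain K where K: "\<And>k. cmod (Y (r k) i j) \<le> K" by (auto simp: Bseq_def)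
    have "cmod (P (r k) i j) \<le> sqrt (Inf N + 1) + cmod (X i j) + K" for k
    proof -
      have "(cmod (Z (Y (r k)) (P (r k)) i j))\<^sup>2 \<le> Inf N + 1 / real (Suc (r k))"
        using entry_le_frob[OF ij] YP(3)[of "r k"] by (meson order_le_less_trans less_imp_le)
      also have "\<dots> \<le> Inf N + 1" by simp
      finally have "cmod (Z (Y (r k)) (P (r k)) i j) \<le> sqrt (Inf N + 1)" by (rule real_le_rsqrt)
      moreover have "P (r k) i j = Z (Y (r k)) (P (r k)) i j - X i j + Y (r k) i j" by (simp add: Z_def)
      then have "cmod (P (r k) i j) \<le> cmod (Z (Y (r k)) (P (r k)) i j) + cmod (X i j) + cmod (Y (r k) i j)"
        using norm_triangle_ineq[of "Z (Y (r k)) (P (r k)) i j - X i j" "Y (r k) i j"]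
          norm_triangle_ineq4[of "Z (Y (r k)) (P (r k)) i j" "X i j"] by simp
      ultimately show ?thesis using K[of k] by linarith
    qed
    then show ?thesis by (rule BseqI')
  qed
  obtain s P0 where s: "strict_mono s" and Plim: "\<And>i j. i < n \<Longrightarrow> j < n \<Longrightarrow> (\<lambda>k. P (r (s k)) i j) \<longlonglongrightarrow> P0 i j"
    using bounded_entries_subseq[of n "\<lambda>k. P (r k)"] Pbdd by blast
  have Ylim': "(\<lambda>k. Y (r (s k)) i j) \<longlonglongrightarrow> Y0 i j" if "i < n" "j < n" for i j
    using LIMSEQ_subseq_LIMSEQ[OF Ylim[OF that] s] by (simp add: o_def)
  have P0: "psd n P0"
    by (rule psd_limit[of n "\<lambda>k. P (r (s k))"]) (use YP(2) Plim in auto)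
  define H where "H = Z Y0 P0"
  have Hlim: "(\<lambda>k. Z (Y (r (s k))) (P (r (s k))) i j) \<longlonglongrightarrow> H i j" if "i < n" "j < n" for i j
    unfolding H_def Z_def using Ylim'[OF that] Plim[OF that] by (intro tendsto_intros)
  have H_min: "frob n H H \<le> Inf N"
  proof (rule LIMSEQ_le)
    show "(\<lambda>k. frob n (Z (Y (r (s k))) (P (r (s k)))) (Z (Y (r (s k))) (P (r (s k))))) \<longlonglongrightarrow> frob n H H"
      by (intro tendsto_frob Hlim)
    have "(\<lambda>k. 1 / real (Suc k)) \<longlonglongrightarrow> 0"
      using LIMSEQ_inverse_real_of_nat by (simp add: inverse_eq_divide)
    from LIMSEQ_subseq_LIMSEQ[OF this strict_mono_o[OF r s]]
    show "(\<lambda>k. Inf N + 1 / real (Suc (r (s k)))) \<longlonglongrightarrow> Inf N"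
      using tendsto_add[OF tendsto_const, of _ 0] by (fastforce simp: o_def)
    show "\<exists>M. \<forall>k\<ge>M. frob n (Z (Y (r (s k))) (P (r (s k)))) (Z (Y (r (s k))) (P (r (s k))))
        \<le> Inf N + 1 / real (Suc (r (s k)))"
      using YP(3) less_imp_le by blast
  qed
  define \<delta> where "\<delta> = frob n H H"
  have "\<delta> > 0"
  proof (rule ccontr)
    assume "\<not> \<delta> > 0"
    have "H i j = 0" if "i < n" "j < n" for i j
    proof -
      have "(cmod (H i j))\<^sup>2 \<le> 0" using entry_le_frob[OF that, of H] \<open>\<not> \<delta> > 0\<close> unfolding \<delta>_def by linarith
      then show ?thesis by simp
    qed
    then have "Y0 i j - X i j = P0 i j" if "i < n" "j < n" for i j
      using that by (simp add: H_def Z_def algebra_simps)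
    then have "psd n (\<lambda>i j. Y0 i j - X i j)" using P0 by (subst psd_cong) auto
    then show False using notin Y0 by blast
  qed
  have key: "\<delta> \<le> frob n H X - frob n H Y + frob n H P" if "Y \<in> C" "psd n P" for Y P
  proof -
    define W where "W i j = Z Y P i j - H i j" for i j
    have "0 \<le> 2 * t * frob n H W + t\<^sup>2 * frob n W W" if t: "0 < t" "t \<le> 1" for t
    proof -
      obtain Yt where Yt: "Yt \<in> C" "\<And>i j. i < n \<Longrightarrow> j < n \<Longrightarrow> Yt i j = complex_of_real (1 - t) * Y0 i j + complex_of_real t * Y i j"
        using convex[OF Y0 \<open>Y \<in> C\<close>, of t] t by force
      define Pt where "Pt i j = complex_of_real (1 - t) * P0 i j + complex_of_real t * P i j" for i j
      have "psd n Pt" unfolding Pt_def using t by (intro psd_add psd_scale P0 \<open>psd n P\<close>) auto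
      then have "Inf N \<le> frob n (Z Yt Pt) (Z Yt Pt)"
        using Yt(1) by (intro cInf_lower[OF _ N_bdd]) (auto simp: N_def)
      then have "frob n H H \<le> frob n (Z Yt Pt) (Z Yt Pt)" using H_min by simp
      also have "\<dots> = frob n (\<lambda>i j. H i j + complex_of_real t * W i j) (\<lambda>i j. H i j + complex_of_real t * W i j)"
        by (rule frob_cong) (simp_all add: Z_def Yt(2) Pt_def H_def W_def algebra_simps)
      also have "\<dots> = frob n H H + 2 * t * frob n H W + t\<^sup>2 * frob n W W"
      proof -
        have sw: "frob n (\<lambda>i j. H i j + complex_of_real t * W i j) V = frob n V H + t * frob n V W" for V
          by (subst frob_commute) (simp add: frob_add_right frob_scale_right)
        show ?thesis unfolding frob_add_right frob_scale_right sw
          by (simp add: frob_commute[of n W H] power2_eq_square algebra_simps)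
      qed
      finally show ?thesis by simp
    qed
    then have "0 \<le> frob n H W" by (rule quadratic_nonneg_slope)
    also have "frob n H W = frob n H X - frob n H Y + frob n H P - \<delta>"
      unfolding W_def Z_def frob_diff_right frob_add_right \<delta>_def by simp
    finally show ?thesis by simp
  qed
  have "psd n H"
    unfolding psd_def
  proof
    fix v
    have H_herm: "cnj (H i j) = H j i" if "i < n" "j < n" for i j
      using C_herm[OF Y0 that] X_herm[OF that] psd_hermitian[OF P0 that] unfolding H_def Z_def by simp
    have "cnj (qform n H v) = (\<Sum>i<n. \<Sum>j<n. H j i * v i * cnj (v j))"
      unfolding qform_def cnj_sum using H_herm by (intro sum.cong) (auto simp: algebra_simps)
    also have "\<dots> = qform n H v" unfolding qform_def by (rule sum.swap)
    finally have "Im (qform n H v) = 0" by (metis Reals_cnj_iff complex_is_Real_iff)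
    moreover have "0 \<le> Re (qform n H v)"
    proof (rule ccontr)
      define q where "q = Re (qform n H v)"
      assume "\<not> 0 \<le> Re (qform n H v)"
      then have q: "q < 0" by (simp add: q_def)
      define K where "K = frob n H X - frob n H Y0"
      have K: "\<delta> \<le> K + t * q" if "0 \<le> t" for t
      proof -
        have "frob n H (\<lambda>i j. complex_of_real t * outer (\<lambda>k. cnj (v k)) i j) = t * q"
          by (simp add: frob_scale_right frob_outer q_def)
        moreover have "psd n (\<lambda>i j. complex_of_real t * outer (\<lambda>k. cnj (v k)) i j)"
          using that by (intro psd_scale psd_outer)
        ultimately show ?thesis using key[OF Y0] by (fastforce simp: K_def)
      qed
      have "K \<ge> 0" using K[of 0] \<open>\<delta> > 0\<close> by simp
      then have "\<delta> \<le> K + (K / - q) * q" using q by (intro K) (auto simp: divide_le_0_iff)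
      then show False using q \<open>\<delta> > 0\<close> by simp
    qed
    ultimately show "0 \<le> qform n H v" by (simp add: less_eq_complex_def)
  qed
  moreover have "frob n H Y + \<delta> \<le> frob n H X" if "Y \<in> C" for Y
    using key[OF that psd_zero] by (simp add: frob_def)
  ultimately show ?thesis using \<open>\<delta> > 0\<close> by blast
qed

section \<open>The norms\<close>

text \<open>The $i$-th coordinate of $X v$, for $v$ given as a function.\<close>

definition image_coord :: "complex mat \<Rightarrow> (nat \<Rightarrow> complex) \<Rightarrow> nat \<Rightarrow> complex" where
  "image_coord X v i = (\<Sum>j<dim_col X. X $$ (i, j) * v j)"

text \<open>The Gram matrix $X^* X$, as the sum of the rank one matrices of the rows of $X$.\<close>

definition gram :: "complex mat \<Rightarrow> nat \<Rightarrow> nat \<Rightarrow> complex" where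
  "gram X i j = (\<Sum>k<dim_row X. outer (\<lambda>j. X $$ (k, j)) i j)"

lemma l2_norm_sq: "(l2_norm v)\<^sup>2 = (\<Sum>i<dim_vec v. (cmod (v $ i))\<^sup>2)"
  by (simp add: l2_norm_def L2_set_def sum_nonneg)

lemma l2_norm_nonneg: "0 \<le> l2_norm v"
  by (simp add: l2_norm_def)

lemma mult_vec_sq:
  assumes "v \<in> carrier_vec (dim_col X)"
  shows "(l2_norm (X *\<^sub>v v))\<^sup>2 = (\<Sum>i<dim_row X. (cmod (image_coord X (\<lambda>j. v $ j) i))\<^sup>2)"
  unfolding l2_norm_sq using assms
  by (intro sum.cong) (auto simp: image_coord_def scalar_prod_def atLeast0LessThan)

lemma qform_gram: "qform (dim_col X) (gram X) v = complex_of_real (\<Sum>i<dim_row X. (cmod (image_coord X v i))\<^sup>2)"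
proof -
  have *: "qform n (\<lambda>i j. \<Sum>k<m. outer (y k) i j) v = (\<Sum>k<m. qform n (outer (y k)) v)" for n m :: nat and y
    by (induction m) (simp_all add: qform_add, simp add: qform_def)
  show ?thesis
    unfolding gram_def[abs_def] * by (simp add: qform_outer image_coord_def)
qed

lemma psd_gram: "psd (dim_col X) (gram X)"
  unfolding psd_def qform_gram by (auto simp: less_eq_complex_def intro!: sum_nonneg)

lemma Re_qform_gram:
  assumes "v \<in> carrier_vec (dim_col X)"
  shows "(l2_norm (X *\<^sub>v v))\<^sup>2 = Re (qform (dim_col X) (gram X) (\<lambda>j. v $ j))"
  by (simp add: mult_vec_sq[OF assms] qform_gram)

lemma bdd_above_mult_vec:
  assumes "V \<subseteq> {v \<in> carrier_vec (dim_col X). \<forall>j<dim_col X. cmod (v $ j) \<le> 1}"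
  shows "bdd_above ((\<lambda>v. l2_norm (X *\<^sub>v v)) ` V)"
proof (rule bdd_aboveI2)
  fix v assume "v \<in> V"
  then have v: "v \<in> carrier_vec (dim_col X)" "\<And>j. j < dim_col X \<Longrightarrow> cmod (v $ j) \<le> 1" using assms by auto
  have "(l2_norm (X *\<^sub>v v))\<^sup>2 \<le> (\<Sum>i<dim_row X. (\<Sum>j<dim_col X. cmod (X $$ (i, j)))\<^sup>2)"
    unfolding mult_vec_sq[OF v(1)]
  proof (intro sum_mono power_mono norm_ge_zero)
    fix i
    show "cmod (image_coord X (\<lambda>j. v $ j) i) \<le> (\<Sum>j<dim_col X. cmod (X $$ (i, j)))"
      unfolding image_coord_def
      by (rule sum_norm_le) (use v(2) in \<open>auto simp: norm_mult intro: mult_left_le\<close>)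
  qed
  then show "l2_norm (X *\<^sub>v v) \<le> sqrt (\<Sum>i<dim_row X. (\<Sum>j<dim_col X. cmod (X $$ (i, j)))\<^sup>2)"
    by (rule real_le_rsqrt)
qed

lemma l2_norm_zero: "l2_norm (0\<^sub>v n) = 0"
  by (simp add: l2_norm_def L2_set_def)

lemma mult_vec_zero: "X *\<^sub>v 0\<^sub>v (dim_col X) = 0\<^sub>v (dim_row X)"
  by (rule eq_vecI) (auto simp: scalar_prod_def)

lemma F_norm_upper:
  assumes "v \<in> carrier_vec (dim_col X)" "\<And>j. j < dim_col X \<Longrightarrow> cmod (v $ j) \<le> 1"
  shows "l2_norm (X *\<^sub>v v) \<le> F_norm X"
  unfolding F_norm_def using assms by (intro cSUP_upper bdd_above_mult_vec) auto

lemma F_norm_least: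
  assumes "\<And>v. v \<in> carrier_vec (dim_col X) \<Longrightarrow> (\<And>j. j < dim_col X \<Longrightarrow> cmod (v $ j) \<le> 1) \<Longrightarrow> l2_norm (X *\<^sub>v v) \<le> c"
  shows "F_norm X \<le> c"
  unfolding F_norm_def
proof (rule cSUP_least)
  have "0\<^sub>v (dim_col X) \<in> {v \<in> carrier_vec (dim_col X). \<forall>j<dim_col X. cmod (v $ j) \<le> 1}" by auto
  then show "{v \<in> carrier_vec (dim_col X). \<forall>j<dim_col X. cmod (v $ j) \<le> 1} \<noteq> {}" by blast
qed (use assms in auto)

lemma F_norm_nonneg: "0 \<le> F_norm X"
  using F_norm_upper[of "0\<^sub>v (dim_col X)" X] by (simp add: mult_vec_zero l2_norm_zero)

lemma op_norm_upper:
  assumes "v \<in> carrier_vec (dim_col X)" "l2_norm v \<le> 1"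
  shows "l2_norm (X *\<^sub>v v) \<le> op_norm X"
  unfolding op_norm_def
proof (intro cSUP_upper bdd_above_mult_vec)
  show "{v \<in> carrier_vec (dim_col X). l2_norm v \<le> 1} \<subseteq> {v \<in> carrier_vec (dim_col X). \<forall>j<dim_col X. cmod (v $ j) \<le> 1}"
  proof clarify
    fix w :: "complex vec" and j assume w: "w \<in> carrier_vec (dim_col X)" "l2_norm w \<le> 1" "j < dim_col X"
    have "cmod (w $ j) \<le> l2_norm w"
      unfolding l2_norm_def using w by (intro member_le_L2_set[of _ j "\<lambda>i. cmod (w $ i)"]) auto
    then show "cmod (w $ j) \<le> 1" using w by simp
  qed
qed (use assms in auto)

lemma op_norm_nonneg: "0 \<le> op_norm X"
  using op_norm_upper[of "0\<^sub>v (dim_col X)" X] by (simp add: mult_vec_zero l2_norm_zero)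

lemma op_norm_least:
  assumes "\<And>v. v \<in> carrier_vec (dim_col X) \<Longrightarrow> l2_norm v \<le> 1 \<Longrightarrow> l2_norm (X *\<^sub>v v) \<le> c"
  shows "op_norm X \<le> c"
  unfolding op_norm_def
proof (rule cSUP_least)
  have "0\<^sub>v (dim_col X) \<in> {v \<in> carrier_vec (dim_col X). l2_norm v \<le> 1}" by (simp add: l2_norm_zero)
  then show "{v \<in> carrier_vec (dim_col X). l2_norm v \<le> 1} \<noteq> {}" by blast
qed (use assms in auto)

lemma l2_norm_smult: "l2_norm (c \<cdot>\<^sub>v v) = cmod c * l2_norm v"
  unfolding l2_norm_def index_smult_vec(2)
  by (subst L2_set_right_distrib) (auto simp: norm_mult intro!: L2_set_cong)

lemma op_norm_bound:
  assumes "v \<in> carrier_vec (dim_col X)"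
  shows "l2_norm (X *\<^sub>v v) \<le> op_norm X * l2_norm v"
proof (cases "l2_norm v = 0")
  case True
  then have "v $ j = 0" if "j < dim_col X" for j
    using assms that by (auto simp: l2_norm_def L2_set_eq_0_iff)
  then have "v = 0\<^sub>v (dim_col X)" using assms by (intro eq_vecI) auto
  then show ?thesis by (simp add: mult_vec_zero l2_norm_zero)
next
  case False
  define r where "r = l2_norm v"
  have r: "r > 0" using False l2_norm_nonneg[of v] by (simp add: r_def)
  define w where "w = complex_of_real (1 / r) \<cdot>\<^sub>v v"
  have w: "w \<in> carrier_vec (dim_col X)" using assms by (simp add: w_def)
  have "l2_norm w = cmod (complex_of_real (1 / r)) * r" unfolding w_def l2_norm_smult r_def ..
  then have "l2_norm w \<le> 1" using r by (simp add: norm_divide)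
  then have "l2_norm (X *\<^sub>v w) \<le> op_norm X" using op_norm_upper w by blast
  moreover have "X *\<^sub>v w = complex_of_real (1 / r) \<cdot>\<^sub>v (X *\<^sub>v v)"
    unfolding w_def using assms by (intro mult_mat_vec[of X "dim_row X" "dim_col X"]) auto
  then have "l2_norm (X *\<^sub>v w) = cmod (complex_of_real (1 / r)) * l2_norm (X *\<^sub>v v)" by (simp only: l2_norm_smult)
  ultimately show ?thesis using r by (simp add: norm_divide r_def[symmetric] field_simps)
qed

text \<open>The diagonal matrix with diagonal $d$.\<close>

abbreviation diag_fun :: "(nat \<Rightarrow> real) \<Rightarrow> nat \<Rightarrow> nat \<Rightarrow> complex" where
  "diag_fun d \<equiv> \<lambda>i j. if i = j then complex_of_real (d i) else 0"

lemma qform_diag: "qform n (diag_fun d) v = complex_of_real (\<Sum>i<n. d i * (cmod (v i))\<^sup>2)"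
proof -
  have "qform n (diag_fun d) v = (\<Sum>i<n. complex_of_real (d i) * v i * cnj (v i))"
    unfolding qform_def by (intro sum.cong refl)
      (simp add: if_distrib[of "\<lambda>z. z * _"] cong: if_cong)
  then show ?thesis by (simp add: complex_norm_square mult.assoc del: of_real_power)
qed

lemma psd_diag_fun:
  assumes "\<And>i. i < n \<Longrightarrow> 0 \<le> d i"
  shows "psd n (diag_fun d)"
  unfolding psd_def qform_diag using assms by (auto simp: less_eq_complex_def intro!: sum_nonneg)

lemma frob_diag_right: "frob n f (diag_fun d) = (\<Sum>i<n. d i * Re (f i i))"
proof -
  have "frob n f (diag_fun d) = (\<Sum>i<n. \<Sum>j<n. if i = j then d i * Re (f i i) else 0)"
    unfolding frob_def by (intro sum.cong refl) auto
  then show ?thesis by simp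
qed

text \<open>The values $\|B\|_\infty$ over which \<^const>\<open>cbF_norm\<close> takes the infimum.\<close>

definition factorization_norms :: "complex mat \<Rightarrow> real set" where
  "factorization_norms X = {op_norm B | B \<xi>.
     B \<in> carrier_mat (dim_row X) (dim_col X) \<and>
     (\<forall>j<dim_col X. (0::real) \<le> \<xi> j) \<and> L2_set \<xi> {..<dim_col X} = 1 \<and>
     X = B * mat_diag (dim_col X) (\<lambda>j. complex_of_real (\<xi> j))}"

lemma cbF_norm_eq_Inf: "cbF_norm X = Inf (factorization_norms X)"
  by (simp add: cbF_norm_def factorization_norms_def)

lemma factorization_norms_nonneg: "b \<in> factorization_norms X \<Longrightarrow> 0 \<le> b"
  by (auto simp: factorization_norms_def op_norm_nonneg)

lemma factorization_norms_memberI: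
  assumes "\<And>j. j < dim_col X \<Longrightarrow> 0 < \<xi> j" "(\<Sum>j<dim_col X. (\<xi> j)\<^sup>2) = 1" "0 \<le> s"
    "\<And>v. Re (qform (dim_col X) (gram X) v) \<le> s * (\<Sum>j<dim_col X. (\<xi> j)\<^sup>2 * (cmod (v j))\<^sup>2)"
  shows "\<exists>b \<in> factorization_norms X. b \<le> sqrt s"
proof -
  define B where "B = mat (dim_row X) (dim_col X) (\<lambda>(i, j). X $$ (i, j) / complex_of_real (\<xi> j))"
  have B: "B \<in> carrier_mat (dim_row X) (dim_col X)" by (simp add: B_def)
  have nz: "\<xi> j \<noteq> 0" if "j < dim_col X" for j using assms(1)[OF that] by simp
  have fac: "X = B * mat_diag (dim_col X) (\<lambda>j. complex_of_real (\<xi> j))"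
    unfolding mat_diag_mult_right[OF B] using nz by (intro eq_matI) (auto simp: B_def)
  have "op_norm B \<le> sqrt s"
  proof (rule op_norm_least)
    fix v assume v: "v \<in> carrier_vec (dim_col B)" "l2_norm v \<le> 1"
    define w where "w j = v $ j / complex_of_real (\<xi> j)" for j
    have "(l2_norm (B *\<^sub>v v))\<^sup>2 = (\<Sum>i<dim_row X. (cmod (image_coord X w i))\<^sup>2)"
      unfolding mult_vec_sq[OF v(1)] by (intro sum.cong) (auto simp: image_coord_def B_def w_def)
    also have "\<dots> \<le> s * (\<Sum>j<dim_col X. (\<xi> j)\<^sup>2 * (cmod (w j))\<^sup>2)"
      using assms(4)[of w] by (simp add: qform_gram)
    also have "(\<Sum>j<dim_col X. (\<xi> j)\<^sup>2 * (cmod (w j))\<^sup>2) = (l2_norm v)\<^sup>2"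
      unfolding l2_norm_sq using v(1) nz
      by (intro sum.cong) (auto simp: w_def B_def norm_divide power_divide)
    also have "s * (l2_norm v)\<^sup>2 \<le> s * 1"
      using v(2) l2_norm_nonneg[of v] assms(3) by (intro mult_left_mono) (auto simp: power_le_one)
    finally show "l2_norm (B *\<^sub>v v) \<le> sqrt s" by (simp add: real_le_rsqrt)
  qed
  moreover have "op_norm B \<in> factorization_norms X"
    unfolding factorization_norms_def using B fac assms(1,2)
    by (intro CollectI exI[of _ B] exI[of _ \<xi>]) (auto simp: L2_set_def less_imp_le)
  ultimately show ?thesis by blast
qed

text \<open>If $X^* X \le s\, \Delta(\xi)^2$ with a strictly positive unit vector $\xi$, then
  $B = X \Delta(\xi)^{-1}$ has norm at most $\sqrt s$.\<close>

lemma cbF_norm_upper: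
  assumes "\<And>j. j < dim_col X \<Longrightarrow> 0 < \<xi> j" "(\<Sum>j<dim_col X. (\<xi> j)\<^sup>2) = 1" "0 \<le> s"
    "\<And>v. Re (qform (dim_col X) (gram X) v) \<le> s * (\<Sum>j<dim_col X. (\<xi> j)\<^sup>2 * (cmod (v j))\<^sup>2)"
  shows "cbF_norm X \<le> sqrt s"
proof -
  obtain b where b: "b \<in> factorization_norms X" "b \<le> sqrt s"
    using factorization_norms_memberI[OF assms] by blast
  have "cbF_norm X \<le> b"
    unfolding cbF_norm_eq_Inf using b(1) factorization_norms_nonneg
    by (intro cInf_lower bdd_belowI[of _ 0]) auto
  then show ?thesis using b by simp
qed

lemma factorization_norms_nonempty:
  assumes "1 \<le> dim_col X"
  shows "factorization_norms X \<noteq> {}"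
proof -
  define n where "n = dim_col X"
  have n: "0 < real n" using assms by (simp add: n_def)
  have "1 / sqrt n > 0" using n by simp
  \<comment> \<open>With constant $\xi_j = 1/\sqrt n$ any sufficiently large $s$ works.\<close>
  define s where "s = (real n) * (\<Sum>i<n. \<Sum>j<n. cmod (gram X i j))"
  have "Re (qform n (gram X) v) \<le> s * (\<Sum>j<n. (1 / sqrt n)\<^sup>2 * (cmod (v j))\<^sup>2)" for v
  proof -
    define S where "S = (\<Sum>j<n. (cmod (v j))\<^sup>2)"
    have "Re (qform n (gram X) v) \<le> cmod (qform n (gram X) v)" by (rule complex_Re_le_cmod)
    also have "\<dots> \<le> (\<Sum>i<n. \<Sum>j<n. cmod (gram X i j) * S)"
      unfolding qform_def
    proof (intro sum_norm_le)
      fix i j assume ij: "i \<in> {..<n}" "j \<in> {..<n}"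
      have "(cmod (v i))\<^sup>2 \<le> S" "(cmod (v j))\<^sup>2 \<le> S"
        unfolding S_def using ij by (auto intro!: member_le_sum)
      moreover have "2 * (cmod (v j) * cmod (v i)) \<le> (cmod (v i))\<^sup>2 + (cmod (v j))\<^sup>2"
        using sum_squares_bound[of "cmod (v i)" "cmod (v j)"] by (simp add: mult_ac)
      ultimately have "cmod (v j) * cmod (v i) \<le> S" by linarith
      then show "cmod (gram X i j * v j * cnj (v i)) \<le> cmod (gram X i j) * S"
        by (simp add: norm_mult mult.assoc mult_left_mono)
    qed
    also have "\<dots> = s * (\<Sum>j<n. (1 / sqrt n)\<^sup>2 * (cmod (v j))\<^sup>2)"
      using n by (simp add: s_def S_def power_divide flip: sum_distrib_left sum_distrib_right sum_divide_distrib)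
    finally show ?thesis .
  qed
  moreover have "(\<Sum>j<n. (1 / sqrt n)\<^sup>2) = 1" using n by (simp add: power_divide)
  moreover have "0 \<le> s" by (simp add: s_def sum_nonneg)
  ultimately show ?thesis
    using factorization_norms_memberI[of X "\<lambda>_. 1 / sqrt n" s] n unfolding n_def by fastforce
qed

lemma cbF_norm_nonneg:
  assumes "1 \<le> dim_col X"
  shows "0 \<le> cbF_norm X"
  unfolding cbF_norm_eq_Inf using factorization_norms_nonneg
  by (intro cInf_greatest factorization_norms_nonempty assms)

text \<open>Weak duality: if $X = B \Delta(\xi)$ and $b = \|B\|_\infty$, then $X^* X \le b^2 \Delta(\xi)^2$, and pairing
  with $Q$ gives $\langle X^* X, Q\rangle \le b^2 \sum_i \xi_i^2 Q_{ii} = b^2$.\<close>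

lemma cbF_norm_lower:
  assumes n: "1 \<le> dim_col X" and Q: "psd (dim_col X) Q" "\<And>i. i < dim_col X \<Longrightarrow> Re (Q i i) = 1"
  shows "frob (dim_col X) (gram X) Q \<le> (cbF_norm X)\<^sup>2"
proof -
  define n where "n = dim_col X"
  define q where "q = frob n (gram X) Q"
  have q0: "0 \<le> q" unfolding q_def n_def by (intro frob_psd_nonneg psd_gram Q)
  have "sqrt q \<le> cbF_norm X"
    unfolding cbF_norm_eq_Inf
  proof (rule cInf_greatest[OF factorization_norms_nonempty[OF n]])
    fix b assume "b \<in> factorization_norms X"
    then obtain B \<xi> where B: "B \<in> carrier_mat (dim_row X) n" and \<xi>: "\<And>j. j < n \<Longrightarrow> 0 \<le> \<xi> j" "L2_set \<xi> {..<n} = 1"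
      and X: "X = B * mat_diag n (\<lambda>j. complex_of_real (\<xi> j))" and b: "b = op_norm B"
      unfolding factorization_norms_def n_def by blast
    have Xe: "X $$ (i, j) = B $$ (i, j) * complex_of_real (\<xi> j)" if "i < dim_row X" "j < n" for i j
      using arg_cong[OF X, of "\<lambda>M. M $$ (i, j)"] that unfolding mat_diag_mult_right[OF B] by simp
    have "0 \<le> qform n (\<lambda>i j. diag_fun (\<lambda>i. b\<^sup>2 * (\<xi> i)\<^sup>2) i j - gram X i j) v" for v
    proof -
      define w where "w = vec n (\<lambda>j. complex_of_real (\<xi> j) * v j)"
      have w: "w \<in> carrier_vec (dim_col B)" using B by (simp add: w_def)
      have "(\<Sum>i<dim_row X. (cmod (image_coord X v i))\<^sup>2) = (l2_norm (B *\<^sub>v w))\<^sup>2"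
        unfolding mult_vec_sq[OF w] using B
        by (intro sum.cong) (auto simp: image_coord_def w_def n_def[symmetric] Xe mult.assoc intro!: arg_cong[of _ _ "\<lambda>z. (cmod z)\<^sup>2"] sum.cong)
      also have "\<dots> \<le> (b * l2_norm w)\<^sup>2"
        unfolding b by (intro power_mono op_norm_bound w l2_norm_nonneg)
      also have "\<dots> = (\<Sum>i<n. b\<^sup>2 * (\<xi> i)\<^sup>2 * (cmod (v i))\<^sup>2)"
        unfolding power_mult_distrib l2_norm_sq
        by (simp add: w_def norm_mult power_mult_distrib sum_distrib_left mult.assoc)
      finally show ?thesis
        unfolding qform_diff qform_diag using qform_gram[of X v] by (simp add: n_def less_eq_complex_def)
    qed
    then have "0 \<le> frob n Q (\<lambda>i j. diag_fun (\<lambda>i. b\<^sup>2 * (\<xi> i)\<^sup>2) i j - gram X i j)"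
      using Q(1) by (intro frob_psd_nonneg) (auto simp: n_def psd_def)
    then have "q \<le> (\<Sum>i<n. b\<^sup>2 * (\<xi> i)\<^sup>2 * Re (Q i i))"
      unfolding frob_diff_right frob_diag_right q_def by (simp add: frob_commute)
    also have "\<dots> = b\<^sup>2 * (\<Sum>i<n. (\<xi> i)\<^sup>2)"
      using Q(2) by (simp add: sum_distrib_left n_def)
    also have "\<dots> = b\<^sup>2" using \<xi>(2) by (simp add: L2_set_def)
    finally show "sqrt q \<le> b" using op_norm_nonneg[of B] b by (intro real_le_lsqrt) (auto simp: q0)
  qed
  then have "(sqrt q)\<^sup>2 \<le> (cbF_norm X)\<^sup>2" using q0 by (intro power_mono) auto
  then show ?thesis using q0 by (simp add: q_def n_def)
qed

section \<open>Duality between the two conditions\<close>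

text \<open>The constants admitted in the definition of \<^const>\<open>little_Grothendieck_const\<close>.\<close>

definition Grothendieck_bound :: "real \<Rightarrow> bool" where
  "Grothendieck_bound k \<longleftrightarrow> 0 \<le> k \<and>
     (\<forall>m\<ge>1. \<forall>n\<ge>1. \<forall>X \<in> carrier_mat m n. cbF_norm X \<le> sqrt k * F_norm X)"

text \<open>The $1 \times 1$ identity matrix has both norms equal to $1$.\<close>

lemma Grothendieck_bound_ge_1:
  assumes "Grothendieck_bound k"
  shows "1 \<le> k"
proof -
  define X :: "complex mat" where "X = 1\<^sub>m 1"
  have [simp]: "dim_col X = 1" "dim_row X = 1" by (auto simp: X_def)
  have X: "X \<in> carrier_mat 1 1" by (simp add: X_def)
  have "frob 1 (gram X) (diag_fun (\<lambda>_. 1)) \<le> (cbF_norm X)\<^sup>2"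
    using cbF_norm_lower[of X "diag_fun (\<lambda>_. 1)"] psd_diag_fun[of 1 "\<lambda>_. 1"] by simp
  then have cb: "1 \<le> (cbF_norm X)\<^sup>2"
    unfolding frob_diag_right by (simp add: gram_def outer_def X_def)
  have "F_norm X \<le> 1"
  proof (rule F_norm_least)
    fix v :: "complex vec" assume "v \<in> carrier_vec (dim_col X)" "\<And>j. j < dim_col X \<Longrightarrow> cmod (v $ j) \<le> 1"
    then show "l2_norm (X *\<^sub>v v) \<le> 1" by (simp add: X_def l2_norm_def L2_set_def)
  qed
  have "0 \<le> k" using assms by (simp add: Grothendieck_bound_def)
  have "cbF_norm X \<le> sqrt k * F_norm X" using assms X by (auto simp: Grothendieck_bound_def)
  also have "\<dots> \<le> sqrt k * 1" using \<open>F_norm X \<le> 1\<close> \<open>0 \<le> k\<close> by (intro mult_left_mono) auto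
  finally have le: "cbF_norm X \<le> sqrt k" by simp
  have "0 \<le> cbF_norm X" by (rule cbF_norm_nonneg) simp
  then have "(cbF_norm X)\<^sup>2 \<le> (sqrt k)\<^sup>2" using le by (intro power_mono)
  then show ?thesis using cb \<open>0 \<le> k\<close> by simp
qed

text \<open>Sequential compactness of the hull: it is contained in $\mathcal Q_n$, whose elements have entries
  of modulus at most $1$.\<close>

lemma R_set_subseq:
  fixes A :: "nat \<Rightarrow> complex mat"
  assumes "\<And>k. A k \<in> R_set n"
  shows "\<exists>R\<in>R_set n. \<exists>r. strict_mono r \<and> (\<forall>i<n. \<forall>j<n. (\<lambda>k. entries (A (r k)) i j) \<longlonglongrightarrow> entries R i j)"
proof -
  have "Bseq (\<lambda>k. entries (A k) i j)" if "i < n" "j < n" for i j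
    by (rule BseqI'[of _ 1]) (use psd_entry_bound[OF R_set_psd(1)[OF assms] _ that] R_set_psd(2)[OF assms] in auto)
  then obtain r L where r: "strict_mono r" "\<And>i j. i < n \<Longrightarrow> j < n \<Longrightarrow> (\<lambda>k. entries (A (r k)) i j) \<longlonglongrightarrow> L i j"
    using bounded_entries_subseq[of n "\<lambda>k. entries (A k)"] by blast
  define R where "R = mat n n (\<lambda>(i, j). L i j)"
  have lim: "(\<lambda>k. entries (A (r k)) i j) \<longlonglongrightarrow> entries R i j" if "i < n" "j < n" for i j
    using r(2)[OF that] that by (simp add: R_def entries_def)
  have "R \<in> carrier_mat n n" by (simp add: R_def)
  then have "R \<in> R_set n"
    using closed_mats_R_set[unfolded closed_mats_def, rule_format, of R n "\<lambda>k. A (r k)"] assms lim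
    unfolding entries_def by blast
  then show ?thesis using r(1) lim by blast
qed

lemma Rdom_of_Grothendieck_bound:
  assumes k: "Grothendieck_bound k" and Q: "psd n Q" "\<And>i. i < n \<Longrightarrow> Re (Q i i) = 1"
  shows "Rdom n k Q"
proof (cases "n = 0")
  case True
  then show ?thesis using R_set_nonempty by (simp add: Rdom_def psd_def qform_def)
next
  case False
  show ?thesis
  proof (rule ccontr)
    assume notdom: "\<not> Rdom n k Q"
    define C where "C = (\<lambda>R i j. complex_of_real k * entries R i j) ` R_set n"
    have "\<exists>H \<delta>. psd n H \<and> 0 < \<delta> \<and> (\<forall>Y\<in>C. frob n H Y + \<delta> \<le> frob n H Q)"
    proof (rule psd_separation)
      fix Y Y' and t :: real assume "Y \<in> C" "Y' \<in> C" and t: "0 \<le> t" "t \<le> 1"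
      then obtain R R' where R: "R \<in> R_set n" "Y = (\<lambda>i j. complex_of_real k * entries R i j)"
        and R': "R' \<in> R_set n" "Y' = (\<lambda>i j. complex_of_real k * entries R' i j)" by (auto simp: C_def)
      define T where "T = complex_of_real (1 - t) \<cdot>\<^sub>m R + complex_of_real t \<cdot>\<^sub>m R'"
      have "T \<in> R_set n" using convex_mats_R_set[of n] R R' t unfolding convex_mats_def T_def by blast
      moreover have "complex_of_real k * entries T i j = complex_of_real (1 - t) * Y i j + complex_of_real t * Y' i j"
        if "i < n" "j < n" for i j
      proof -
        have "R \<in> carrier_mat n n" "R' \<in> carrier_mat n n" using R R' R_set_carrier by auto
        then have "entries T i j = complex_of_real (1 - t) * entries R i j + complex_of_real t * entries R' i j"
          unfolding T_def using that by (intro entries_convex_comb)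
        moreover have "c * (a * x + b * y) = a * (c * x) + b * (c * y)" for a b c x y :: complex
          by (simp add: algebra_simps)
        ultimately show ?thesis by (simp only: R(2) R'(2))
      qed
      ultimately show "\<exists>Z\<in>C. \<forall>i<n. \<forall>j<n. Z i j = complex_of_real (1 - t) * Y i j + complex_of_real t * Y' i j"
        by (intro bexI[of _ "\<lambda>i j. complex_of_real k * entries T i j"]) (simp_all add: C_def)
    next
      fix S :: "nat \<Rightarrow> nat \<Rightarrow> nat \<Rightarrow> complex" assume "\<And>l. S l \<in> C"
      then obtain A where A: "\<And>l. A l \<in> R_set n" "\<And>l. S l = (\<lambda>i j. complex_of_real k * entries (A l) i j)"
        unfolding C_def image_iff by metis
      obtain R where R: "R \<in> R_set n" and ex: "\<exists>r. strict_mono r \<and>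
          (\<forall>i<n. \<forall>j<n. (\<lambda>l. entries (A (r l)) i j) \<longlonglongrightarrow> entries R i j)"
        using R_set_subseq[of A n, OF A(1)] by (rule bexE)
      from ex obtain r where "strict_mono r"
          "\<forall>i<n. \<forall>j<n. (\<lambda>l. entries (A (r l)) i j) \<longlonglongrightarrow> entries R i j"
        by (elim exE conjE)
      then show "\<exists>Y\<in>C. \<exists>r. strict_mono r \<and> (\<forall>i<n. \<forall>j<n. (\<lambda>l. S (r l) i j) \<longlonglongrightarrow> Y i j)"
        unfolding C_def A(2) by (intro bexI[of _ "\<lambda>i j. complex_of_real k * entries R i j"] exI[of _ r])
          (use R in \<open>auto intro: tendsto_mult_left\<close>)
    next
      show "C \<noteq> {}" using R_set_nonempty by (auto simp: C_def)
    next
      fix Y i j assume "Y \<in> C" "i < n" "j < n"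
      then show "Y j i = cnj (Y i j)"
        using psd_hermitian[OF R_set_psd(1), of _ n i j] by (auto simp: C_def)
    next
      fix i j assume "i < n" "j < n"
      then show "Q j i = cnj (Q i j)" by (rule psd_hermitian[OF Q(1)])
    next
      fix Y assume "Y \<in> C"
      then show "\<not> psd n (\<lambda>i j. Y i j - Q i j)" using notdom by (auto simp: C_def Rdom_def)
    qed
    then obtain H \<delta> where H: "psd n H" "0 < \<delta>"
      and sep: "\<And>R. R \<in> R_set n \<Longrightarrow> frob n H (\<lambda>i j. complex_of_real k * entries R i j) + \<delta> \<le> frob n H Q"
      unfolding C_def by blast
    have sep': "k * frob n H (entries R) \<le> frob n H Q - \<delta>" if "R \<in> R_set n" for R
      using sep[OF that] unfolding frob_scale_right by simp
    obtain y where y: "\<And>i j. i < n \<Longrightarrow> j < n \<Longrightarrow> H i j = (\<Sum>l<n. outer (y l) i j)"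
      using psd_sum_outer[OF H(1)] by blast
    define X where "X = mat n n (\<lambda>(l, j). y l j)"
    have [simp]: "dim_col X = n" "dim_row X = n" and X: "X \<in> carrier_mat n n" by (auto simp: X_def)
    have gram: "gram X i j = H i j" if "i < n" "j < n" for i j
      using y[OF that] that by (simp add: gram_def X_def outer_def)
    have k1: "1 \<le> k" by (rule Grothendieck_bound_ge_1[OF k])
    define q where "q = frob n H Q"
    have "F_norm X \<le> sqrt ((q - \<delta>) / k)"
    proof (rule F_norm_least)
      fix v assume v: "v \<in> carrier_vec (dim_col X)" "\<And>j. j < dim_col X \<Longrightarrow> cmod (v $ j) \<le> 1"
      obtain R where R: "R \<in> R_set n" "psd n (\<lambda>i j. complex_of_real 1 * entries R i j - outer (\<lambda>j. cnj (v $ j)) i j)"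
        using Rdom_outer[of n "\<lambda>j. cnj (v $ j)"] v(2) by (auto simp: Rdom_def)
      have "qform n (gram X) (\<lambda>j. v $ j) = qform n H (\<lambda>j. v $ j)"
        by (rule qform_cong[OF gram]) auto
      then have "(l2_norm (X *\<^sub>v v))\<^sup>2 = Re (qform n H (\<lambda>j. v $ j))"
        using Re_qform_gram[OF v(1)] by simp
      also have "\<dots> = frob n H (outer (\<lambda>j. cnj (v $ j)))" by (simp add: frob_outer)
      also have "\<dots> \<le> frob n H (entries R)"
        using frob_psd_nonneg[OF H(1) R(2)] by (simp add: frob_diff_right)
      finally have "k * (l2_norm (X *\<^sub>v v))\<^sup>2 \<le> k * frob n H (entries R)"
        using k1 by (intro mult_left_mono) auto
      also have "\<dots> \<le> q - \<delta>" unfolding q_def by (rule sep'[OF R(1)])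
      finally have "(l2_norm (X *\<^sub>v v))\<^sup>2 \<le> (q - \<delta>) / k" using k1 by (simp add: field_simps)
      then show "l2_norm (X *\<^sub>v v) \<le> sqrt ((q - \<delta>) / k)" by (rule real_le_rsqrt)
    qed
    then have "\<bar>F_norm X\<bar> \<le> sqrt ((q - \<delta>) / k)" using F_norm_nonneg[of X] by simp
    then have F: "(F_norm X)\<^sup>2 \<le> (q - \<delta>) / k" by (rule sqrt_ge_absD)
    have "q \<le> (cbF_norm X)\<^sup>2"
    proof -
      have "frob n (gram X) Q = q" unfolding q_def by (rule frob_cong[OF gram]) auto
      then show ?thesis using cbF_norm_lower[of X Q] False Q by simp
    qed
    also have "\<dots> \<le> (sqrt k * F_norm X)\<^sup>2"
    proof (rule power_mono)
      show "cbF_norm X \<le> sqrt k * F_norm X"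
        using k[unfolded Grothendieck_bound_def, THEN conjunct2, rule_format, of n n X] X False by linarith
      show "0 \<le> cbF_norm X" using False by (intro cbF_norm_nonneg) simp
    qed
    also have "\<dots> = k * (F_norm X)\<^sup>2" using k1 by (simp add: power_mult_distrib)
    also have "\<dots> \<le> k * ((q - \<delta>) / k)" using F k1 by (intro mult_left_mono) auto
    also have "\<dots> = q - \<delta>" using k1 by simp
    finally show False using H(2) by simp
  qed
qed

text \<open>On a generator given by $u$ the pairing is $\|X \bar u\|^2$, and the inequality passes to the closed
  convex hull.\<close>

lemma frob_gram_R_set_le:
  assumes R: "R \<in> R_set (dim_col X)"
  shows "frob (dim_col X) (gram X) (entries R) \<le> (F_norm X)\<^sup>2"
proof -
  define n where "n = dim_col X"
  have "R \<in> {R \<in> carrier_mat n n. frob n (gram X) (entries R) \<le> (F_norm X)\<^sup>2}" (is "R \<in> ?S")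
  proof (rule R_set_induct[OF R[folded n_def]])
    show "convex_mats ?S"
      unfolding convex_mats_def
    proof (intro ballI allI impI)
      fix A B and t :: real
      assume A: "A \<in> ?S" and B: "B \<in> ?S" and t: "0 \<le> t" "t \<le> 1"
      define T where "T = complex_of_real (1 - t) \<cdot>\<^sub>m A + complex_of_real t \<cdot>\<^sub>m B"
      have "frob n (gram X) (entries T) = frob n (gram X) (\<lambda>i j. complex_of_real (1 - t) * entries A i j + complex_of_real t * entries B i j)"
        unfolding T_def using A B by (intro frob_cong entries_convex_comb) auto
      also have "\<dots> = (1 - t) * frob n (gram X) (entries A) + t * frob n (gram X) (entries B)"
        by (simp only: frob_add_right frob_scale_right)
      also have "\<dots> \<le> (F_norm X)\<^sup>2"
        using A B t by (intro convex_bound_le) auto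
      finally show "complex_of_real (1 - t) \<cdot>\<^sub>m A + complex_of_real t \<cdot>\<^sub>m B \<in> ?S"
        using A B by (auto simp: T_def)
    qed
    show "closed_mats n ?S"
      unfolding closed_mats_def
    proof (intro ballI allI impI)
      fix A :: "nat \<Rightarrow> complex mat" and L :: "complex mat"
      assume *: "L \<in> carrier_mat n n" "\<forall>k. A k \<in> ?S"
        "\<forall>i<n. \<forall>j<n. (\<lambda>k. A k $$ (i, j)) \<longlonglongrightarrow> L $$ (i, j)"
      have "(\<lambda>k. frob n (gram X) (entries (A k))) \<longlonglongrightarrow> frob n (gram X) (entries L)"
        using * by (intro tendsto_frob) (auto simp: entries_def)
      then have "frob n (gram X) (entries L) \<le> (F_norm X)\<^sup>2"
        by (rule LIMSEQ_le_const2) (use * in auto)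
      then show "L \<in> ?S" using * by auto
    qed
  next
    fix u :: "complex vec" assume u: "u \<in> carrier_vec n" "\<forall>j<n. cmod (u $ j) = 1"
    define v where "v = vec n (\<lambda>j. cnj (u $ j))"
    have v: "v \<in> carrier_vec (dim_col X)" by (simp add: v_def n_def)
    have "frob n (gram X) (entries (mat n n (\<lambda>(i, j). cnj (u $ i) * u $ j))) = frob n (gram X) (outer (\<lambda>j. u $ j))"
      by (rule frob_cong) (auto simp: entries_def outer_def)
    also have "\<dots> = Re (qform n (gram X) (\<lambda>j. v $ j))"
      unfolding frob_outer by (intro arg_cong[of _ _ Re] qform_cong) (auto simp: v_def)
    also have "\<dots> = (l2_norm (X *\<^sub>v v))\<^sup>2" using Re_qform_gram[OF v] by (simp add: n_def)
    also have "\<dots> \<le> (F_norm X)\<^sup>2"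
      using F_norm_upper[OF v] u by (intro power_mono l2_norm_nonneg) (auto simp: v_def n_def)
    finally show "mat n n (\<lambda>(i, j). cnj (u $ i) * u $ j) \<in> ?S" by auto
  qed auto
  then show ?thesis by (simp add: n_def)
qed

lemma trace_simplex_subseq:
  fixes d :: "nat \<Rightarrow> nat \<Rightarrow> real"
  assumes "\<And>k i. i < n \<Longrightarrow> 0 \<le> d k i" "\<And>k. (\<Sum>i<n. d k i) = s"
  shows "\<exists>r e. strict_mono r \<and> (\<forall>i<n. 0 \<le> e i) \<and> (\<Sum>i<n. e i) = s \<and> (\<forall>i<n. (\<lambda>k. d (r k) i) \<longlonglongrightarrow> e i)"
proof -
  have "\<exists>r l. strict_mono r \<and> (\<forall>i\<in>{..<n}. (\<lambda>k. complex_of_real (d (r k) i)) \<longlonglongrightarrow> l i)"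
  proof (rule bounded_family_subseq)
    fix i assume i: "i \<in> {..<n}"
    have "d k i \<le> s" for k
      unfolding assms(2)[of k, symmetric] using assms(1) i by (intro member_le_sum) auto
    then show "Bseq (\<lambda>k. complex_of_real (d k i))"
      using assms(1) i by (intro BseqI'[of _ s]) auto
  qed simp
  then obtain r l where r: "strict_mono r" "\<And>i. i < n \<Longrightarrow> (\<lambda>k. complex_of_real (d (r k) i)) \<longlonglongrightarrow> l i" by blast
  have lim: "(\<lambda>k. d (r k) i) \<longlonglongrightarrow> Re (l i)" if "i < n" for i using tendsto_Re[OF r(2)[OF that]] by simp
  have "0 \<le> Re (l i)" if "i < n" for i
    by (rule LIMSEQ_le_const[OF lim[OF that]]) (use assms(1) that in auto)
  moreover have "(\<lambda>k. \<Sum>i<n. d (r k) i) \<longlonglongrightarrow> (\<Sum>i<n. Re (l i))" using lim by (intro tendsto_sum) auto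
  then have "(\<Sum>i<n. Re (l i)) = s" by (simp add: assms(2) LIMSEQ_const_iff)
  ultimately show ?thesis using r(1) lim by (intro exI[of _ r] exI[of _ "\<lambda>i. Re (l i)"]) auto
qed

text \<open>Strong duality for the semidefinite program that minimizes the trace of a diagonal matrix
  dominating $A$. A separating $H$ from the failure of domination satisfies $s H_{pp} < \langle H, A\rangle$ at
  its largest diagonal entry $H_{pp}$, which contradicts the bound for $f = H / H_{pp}$. If
  $H_{pp} = 0$, then $H = 0$, which the strict separation excludes.\<close>

lemma diagonal_domination:
  assumes A: "psd n A" and n: "1 \<le> n" and s: "0 \<le> s"
    and bound: "\<And>f. psd n f \<Longrightarrow> (\<And>i. i < n \<Longrightarrow> Re (f i i) \<le> 1) \<Longrightarrow> frob n A f \<le> s"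
  shows "\<exists>d. (\<forall>i<n. 0 \<le> d i) \<and> (\<Sum>i<n. d i) = s \<and> psd n (\<lambda>i j. diag_fun d i j - A i j)"
proof (rule ccontr)
  assume no: "\<nexists>d. (\<forall>i<n. 0 \<le> d i) \<and> (\<Sum>i<n. d i) = s \<and> psd n (\<lambda>i j. diag_fun d i j - A i j)"
  define D where "D = {d :: nat \<Rightarrow> real. (\<forall>i<n. 0 \<le> d i) \<and> (\<Sum>i<n. d i) = s}"
  have unit: "(\<lambda>i. if i = p then s else 0) \<in> D" if "p < n" for p using that s by (auto simp: D_def)
  have "\<exists>H \<delta>. psd n H \<and> 0 < \<delta> \<and> (\<forall>Y\<in>diag_fun ` D. frob n H Y + \<delta> \<le> frob n H A)"
  proof (rule psd_separation)
    fix Y Y' and t :: real assume "Y \<in> diag_fun ` D" "Y' \<in> diag_fun ` D" and t: "0 \<le> t" "t \<le> 1"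
    then obtain d d' where d: "d \<in> D" "Y = diag_fun d" and d': "d' \<in> D" "Y' = diag_fun d'" by auto
    have "(\<lambda>i. (1 - t) * d i + t * d' i) \<in> D"
    proof -
      have "(\<Sum>i<n. (1 - t) * d i + t * d' i) = (1 - t) * s + t * s"
        using d(1) d'(1) by (simp only: sum.distrib flip: sum_distrib_left) (simp add: D_def)
      also have "\<dots> = s" by (simp add: algebra_simps)
      finally show ?thesis using d(1) d'(1) t by (simp add: D_def)
    qed
    then show "\<exists>Z\<in>diag_fun ` D. \<forall>i<n. \<forall>j<n. Z i j = complex_of_real (1 - t) * Y i j + complex_of_real t * Y' i j"
      by (intro bexI[of _ "diag_fun (\<lambda>i. (1 - t) * d i + t * d' i)"]) (auto simp: d d')
  next
    fix S :: "nat \<Rightarrow> nat \<Rightarrow> nat \<Rightarrow> complex" assume "\<And>l. S l \<in> diag_fun ` D"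
    then obtain d where d: "\<And>l. d l \<in> D" "\<And>l. S l = diag_fun (d l)"
      unfolding image_iff by metis
    obtain r e where "strict_mono r" "e \<in> D" "\<And>i. i < n \<Longrightarrow> (\<lambda>k. d (r k) i) \<longlonglongrightarrow> e i"
      using trace_simplex_subseq[of n d s] d(1) by (auto simp: D_def)
    then show "\<exists>Y\<in>diag_fun ` D. \<exists>r. strict_mono r \<and> (\<forall>i<n. \<forall>j<n. (\<lambda>l. S (r l) i j) \<longlonglongrightarrow> Y i j)"
      unfolding d(2) by (intro bexI[of _ "diag_fun e"] exI[of _ r]) (auto intro: tendsto_of_real)
  next
    show "diag_fun ` D \<noteq> {}" using unit[of 0] n by auto
  next
    fix i j assume "i < n" "j < n"
    then show "A j i = cnj (A i j)" by (rule psd_hermitian[OF A])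
  qed (use no in \<open>auto simp: D_def\<close>)
  then obtain H \<delta> where H: "psd n H" "0 < \<delta>" and sep: "\<And>d. d \<in> D \<Longrightarrow> frob n H (diag_fun d) + \<delta> \<le> frob n H A"
    by blast
  have "\<exists>p<n. \<forall>i<n. Re (H i i) \<le> Re (H p p)"
  proof -
    have "Max ((\<lambda>i. Re (H i i)) ` {..<n}) \<in> (\<lambda>i. Re (H i i)) ` {..<n}" using n by (intro Max_in) (auto simp: lessThan_empty_iff)
    then obtain p where "p < n" "Max ((\<lambda>i. Re (H i i)) ` {..<n}) = Re (H p p)" by auto
    then show ?thesis by (intro exI[of _ p]) (auto simp flip: \<open>Max _ = _\<close>)
  qed
  then obtain p where p: "p < n" "\<And>i. i < n \<Longrightarrow> Re (H i i) \<le> Re (H p p)" by blast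
  define h where "h = Re (H p p)"
  have "frob n H (diag_fun (\<lambda>i. if i = p then s else 0)) = s * h"
    unfolding frob_diag_right using p(1) by (simp add: h_def if_distrib[of "\<lambda>x. x * _"] cong: if_cong)
  then have sh: "s * h + \<delta> \<le> frob n H A" using sep[OF unit[OF p(1)]] by simp
  have "0 \<le> h" unfolding h_def by (rule psd_diag(2)[OF H(1) p(1)])
  show False
  proof (cases "h = 0")
    case True
    have "H i j = 0" if "i < n" "j < n" for i j
    proof (rule psd_zero_row[OF H(1) that])
      have "Re (H i i) = 0" using p(2)[OF that(1)] psd_diag(2)[OF H(1) that(1)] True h_def by simp
      then show "H i i = 0" using psd_diag(1)[OF H(1) that(1)] by simp
    qed
    then have "frob n H A = 0" by (simp add: frob_def)
    then show False using sh True H(2) by simp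
  next
    case False
    then have h: "h > 0" using \<open>0 \<le> h\<close> by simp
    have "frob n A (\<lambda>i j. complex_of_real (1 / h) * H i j) \<le> s"
    proof (rule bound)
      show "psd n (\<lambda>i j. complex_of_real (1 / h) * H i j)" using h by (intro psd_scale H(1)) auto
    qed (use h p(2) in \<open>auto simp: h_def\<close>)
    then have "frob n H A \<le> s * h"
      unfolding frob_scale_right using h by (simp add: frob_commute[of n A H] field_simps)
    then show False using sh H(2) by simp
  qed
qed

text \<open>The diagonal matrix $D \ge X^* X$ of trace $s$ may have zeros on its diagonal, so
  $D + \epsilon I$ is normalized to obtain a strictly positive $\xi$, and then $\epsilon$ tends to $0$.\<close>

lemma Grothendieck_bound_of_Rdom:
  assumes \<beta>: "0 \<le> \<beta>" and dom: "\<And>n f. psd n f \<Longrightarrow> (\<And>i. i < n \<Longrightarrow> Re (f i i) \<le> 1) \<Longrightarrow> Rdom n \<beta> f"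
  shows "Grothendieck_bound \<beta>"
  unfolding Grothendieck_bound_def
proof (intro conjI allI impI ballI \<beta>)
  fix m n :: nat and X :: "complex mat"
  assume n: "1 \<le> n" and "X \<in> carrier_mat m n"
  then have X [simp]: "dim_row X = m" "dim_col X = n" by auto
  define s where "s = \<beta> * (F_norm X)\<^sup>2"
  have s: "0 \<le> s" using \<beta> by (simp add: s_def)
  have A: "psd n (gram X)" using psd_gram[of X] by simp
  have "frob n (gram X) f \<le> s" if f: "psd n f" "\<And>i. i < n \<Longrightarrow> Re (f i i) \<le> 1" for f
  proof -
    obtain R where R: "R \<in> R_set n" "psd n (\<lambda>i j. complex_of_real \<beta> * entries R i j - f i j)"
      using dom[OF f] by (auto simp: Rdom_def)
    have "frob n (gram X) f \<le> \<beta> * frob n (gram X) (entries R)"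
      using frob_psd_nonneg[OF A R(2)] unfolding frob_diff_right frob_scale_right by simp
    also have "\<dots> \<le> s"
      unfolding s_def using frob_gram_R_set_le[of R X] R(1) \<beta> by (intro mult_left_mono) auto
    finally show ?thesis .
  qed
  then obtain d where d: "\<And>i. i < n \<Longrightarrow> 0 \<le> d i" "(\<Sum>i<n. d i) = s"
    and dA: "psd n (\<lambda>i j. diag_fun d i j - gram X i j)"
    using diagonal_domination[OF A n s] by blast
  have approx: "cbF_norm X \<le> sqrt (s + real n * \<epsilon>)" if \<epsilon>: "\<epsilon> > 0" for \<epsilon>
  proof -
    define s' where "s' = s + real n * \<epsilon>"
    have s': "s' > 0" using s n \<epsilon> by (auto simp: s'_def intro!: add_nonneg_pos)
    define \<xi> where "\<xi> j = sqrt ((d j + \<epsilon>) / s')" for j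
    have sq: "(\<xi> j)\<^sup>2 = (d j + \<epsilon>) / s'" if "j < n" for j
      unfolding \<xi>_def using d(1)[OF that] \<epsilon> s' by simp
    show ?thesis
      unfolding s'_def[symmetric]
    proof (rule cbF_norm_upper)
      fix j assume "j < dim_col X"
      then have "0 \<le> d j" using d(1) by simp
      then have "0 < d j + \<epsilon>" using \<epsilon> by simp
      then show "0 < \<xi> j" using s' by (simp add: \<xi>_def)
    next
      have "(\<Sum>j<n. (\<xi> j)\<^sup>2) = (\<Sum>j<n. d j + \<epsilon>) / s'"
        using sq by (simp add: sum_divide_distrib)
      also have "(\<Sum>j<n. d j + \<epsilon>) = s'" by (simp add: sum.distrib d(2) s'_def)
      finally show "(\<Sum>j<dim_col X. (\<xi> j)\<^sup>2) = 1" using s' by simp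
    next
      show "0 \<le> s'" using s' by simp
    next
      fix v
      have "0 \<le> qform n (\<lambda>i j. diag_fun d i j - gram X i j) v" using dA by (simp add: psd_def)
      then have "Re (qform n (gram X) v) \<le> (\<Sum>j<n. d j * (cmod (v j))\<^sup>2)"
        unfolding qform_diff qform_diag by (simp add: less_eq_complex_def)
      also have "\<dots> \<le> (\<Sum>j<n. s' * ((\<xi> j)\<^sup>2 * (cmod (v j))\<^sup>2))"
      proof (rule sum_mono)
        fix j assume "j \<in> {..<n}"
        then have "s' * ((\<xi> j)\<^sup>2 * (cmod (v j))\<^sup>2) = (d j + \<epsilon>) * (cmod (v j))\<^sup>2"
          using sq[of j] s' by simp
        then show "d j * (cmod (v j))\<^sup>2 \<le> s' * ((\<xi> j)\<^sup>2 * (cmod (v j))\<^sup>2)"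
          using \<epsilon> by (simp add: distrib_right)
      qed
      finally show "Re (qform (dim_col X) (gram X) v) \<le> s' * (\<Sum>j<dim_col X. (\<xi> j)\<^sup>2 * (cmod (v j))\<^sup>2)"
        by (simp add: sum_distrib_left)
    qed
  qed
  have "cbF_norm X \<le> sqrt (s + real n * (1 / real (Suc k)))" for k
    by (rule approx) simp
  moreover have "(\<lambda>k. sqrt (s + real n * (1 / real (Suc k)))) \<longlonglongrightarrow> sqrt (s + real n * 0)"
    using LIMSEQ_inverse_real_of_nat by (intro tendsto_intros) (simp add: inverse_eq_divide)
  ultimately have "cbF_norm X \<le> sqrt (s + real n * 0)"
    by (intro LIMSEQ_le_const) auto
  then show "cbF_norm X \<le> sqrt \<beta> * F_norm X"
    using F_norm_nonneg[of X] by (simp add: s_def real_sqrt_mult)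
qed

lemma Q_subset_iff:
  "Q_set n \<subseteq> R_minus_psd n \<alpha> \<longleftrightarrow> (\<forall>f. psd n f \<longrightarrow> (\<forall>i<n. Re (f i i) = 1) \<longrightarrow> Rdom n \<alpha> f)"
proof
  assume sub: "Q_set n \<subseteq> R_minus_psd n \<alpha>"
  show "\<forall>f. psd n f \<longrightarrow> (\<forall>i<n. Re (f i i) = 1) \<longrightarrow> Rdom n \<alpha> f"
  proof (intro allI impI)
    fix f assume f: "psd n f" "\<forall>i<n. Re (f i i) = 1"
    define X where "X = mat n n (\<lambda>(i, j). f i j)"
    have Xf: "entries X i j = f i j" if "i < n" "j < n" for i j using that by (simp add: X_def entries_def)
    have "f i i = 1" if "i < n" for i using psd_diag(1)[OF f(1) that] f(2) that by simp
    then have "X \<in> Q_set n"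
      unfolding Q_set_def using f(1) psd_cong[OF Xf] Xf by (auto simp: psd_mats_iff X_def)
    then obtain R P where R: "R \<in> R_set n" and P: "P \<in> psd_mats n" and XRP: "X = complex_of_real \<alpha> \<cdot>\<^sub>m R - P"
      using sub by (auto simp: R_minus_psd_def)
    have "entries P i j = complex_of_real \<alpha> * entries R i j - f i j" if "i < n" "j < n" for i j
    proof -
      have "R \<in> carrier_mat n n" "P \<in> carrier_mat n n" using R P R_set_carrier by (auto simp: psd_mats_iff)
      then have "f i j = complex_of_real \<alpha> * entries R i j - entries P i j"
        using Xf[OF that] that unfolding XRP by (simp add: entries_def)
      then show ?thesis by simp
    qed
    then have "psd n (\<lambda>i j. complex_of_real \<alpha> * entries R i j - f i j)"
      using P psd_cong[of n "entries P"] by (auto simp: psd_mats_iff)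
    then show "Rdom n \<alpha> f" using R by (auto simp: Rdom_def)
  qed
next
  assume dom: "\<forall>f. psd n f \<longrightarrow> (\<forall>i<n. Re (f i i) = 1) \<longrightarrow> Rdom n \<alpha> f"
  show "Q_set n \<subseteq> R_minus_psd n \<alpha>"
  proof
    fix X assume X: "X \<in> Q_set n"
    then have carr: "X \<in> carrier_mat n n" by (auto simp: Q_set_def psd_mats_iff)
    have "Rdom n \<alpha> (entries X)" using X dom by (auto simp: Q_set_def psd_mats_iff entries_def)
    then obtain R where R: "R \<in> R_set n" "psd n (\<lambda>i j. complex_of_real \<alpha> * entries R i j - entries X i j)"
      by (auto simp: Rdom_def)
    have Rc: "R \<in> carrier_mat n n" using R R_set_carrier by auto
    define P where "P = complex_of_real \<alpha> \<cdot>\<^sub>m R - X"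
    have "entries P i j = complex_of_real \<alpha> * entries R i j - entries X i j" if "i < n" "j < n" for i j
      using that carr Rc by (auto simp: P_def entries_def)
    then have "P \<in> psd_mats n"
      using R(2) psd_cong[of n "entries P"] carr Rc by (auto simp: psd_mats_iff P_def)
    moreover have "X = complex_of_real \<alpha> \<cdot>\<^sub>m R - P"
      using carr Rc by (intro eq_matI) (auto simp: P_def)
    ultimately show "X \<in> R_minus_psd n \<alpha>" using R(1) by (auto simp: R_minus_psd_def)
  qed
qed

text \<open>Raising the diagonal entries to $1$ only increases the matrix.\<close>

lemma Rdom_subunit_diag:
  assumes dom: "\<And>f. psd n f \<Longrightarrow> (\<And>i. i < n \<Longrightarrow> Re (f i i) = 1) \<Longrightarrow> Rdom n \<alpha> f"
    and f: "psd n f" "\<And>i. i < n \<Longrightarrow> Re (f i i) \<le> 1"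
  shows "Rdom n \<alpha> f"
proof -
  define d where "d i = 1 - Re (f i i)" for i
  have d: "psd n (diag_fun d)" using f(2) by (intro psd_diag_fun) (auto simp: d_def)
  have "Rdom n \<alpha> (\<lambda>i j. f i j + diag_fun d i j)"
    by (intro dom psd_add f(1) d) (auto simp: d_def)
  then show ?thesis by (rule Rdom_diff_psd) (use d in simp)
qed

lemma Grothendieck_bound_iff:
  assumes "0 < k"
  shows "Grothendieck_bound k \<longleftrightarrow> (\<forall>n. Q_set n \<subseteq> R_minus_psd n k)"
proof
  assume "Grothendieck_bound k"
  then show "\<forall>n. Q_set n \<subseteq> R_minus_psd n k"
    unfolding Q_subset_iff using Rdom_of_Grothendieck_bound by blast
next
  assume sub: "\<forall>n. Q_set n \<subseteq> R_minus_psd n k"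
  show "Grothendieck_bound k"
  proof (rule Grothendieck_bound_of_Rdom)
    fix n f assume "psd n f" "\<And>i. i < n \<Longrightarrow> Re (f i i) \<le> 1"
    moreover have "Rdom n k g" if "psd n g" "\<And>i. i < n \<Longrightarrow> Re (g i i) = 1" for g
      using sub[rule_format, of n] that unfolding Q_subset_iff by blast
    ultimately show "Rdom n k f" by (rule Rdom_subunit_diag[rotated])
  qed (use assms in simp)
qed

section \<open>The least constant\<close>

lemma little_Grothendieck_const_least:
  shows "Grothendieck_bound little_Grothendieck_const"
    "Grothendieck_bound k \<Longrightarrow> little_Grothendieck_const \<le> k"
proof -
  define T where "T = {k. Grothendieck_bound k}"
  define k0 where "k0 = Inf T"
  have T_ne: "T \<noteq> {}"
    using Grothendieck_bound_of_Rdom[of 49] Rdom_uniform_bound by (auto simp: T_def)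
  have T_bdd: "bdd_below T" by (rule bdd_belowI[of _ 1]) (auto simp: T_def Grothendieck_bound_ge_1)
  have k0: "1 \<le> k0"
    unfolding k0_def using T_ne by (intro cInf_greatest) (auto simp: T_def Grothendieck_bound_ge_1)
  have bound: "Grothendieck_bound k0"
    unfolding Grothendieck_bound_def
  proof (intro conjI allI impI ballI)
    fix m n :: nat and X :: "complex mat"
    assume mn: "1 \<le> m" "1 \<le> n" and X: "X \<in> carrier_mat m n"
    have le: "cbF_norm X \<le> sqrt k * F_norm X" if "k \<in> T" for k
      using that mn X by (auto simp: T_def Grothendieck_bound_def)
    show "cbF_norm X \<le> sqrt k0 * F_norm X"
    proof (cases "F_norm X = 0")
      case True
      then show ?thesis using T_ne le by auto
    next
      case False
      then have F: "F_norm X > 0" using F_norm_nonneg[of X] by simp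
      show ?thesis
      proof (rule ccontr)
        assume "\<not> cbF_norm X \<le> sqrt k0 * F_norm X"
        then have gt: "sqrt k0 < cbF_norm X / F_norm X" using F by (simp add: field_simps)
        have "k0 < (cbF_norm X / F_norm X)\<^sup>2"
          using power_strict_mono[OF gt, of 2] k0 by simp
        then obtain k where k: "k \<in> T" "k < (cbF_norm X / F_norm X)\<^sup>2"
          unfolding k0_def using cInf_lessD[OF T_ne] by blast
        have "0 \<le> sqrt k0" using k0 by simp
        then have "0 < cbF_norm X / F_norm X" using gt by linarith
        then have "sqrt k < cbF_norm X / F_norm X"
          using real_sqrt_less_mono[OF k(2)] by simp
        then show False using le[OF k(1)] F by (simp add: field_simps)
      qed
    qed
  qed (use k0 in simp)
  have "little_Grothendieck_const = k0"
    unfolding little_Grothendieck_const_def Grothendieck_bound_def[symmetric]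
  proof (rule Least_equality)
    show "Grothendieck_bound k0" by (rule bound)
    fix k assume "Grothendieck_bound k"
    then show "k0 \<le> k" unfolding k0_def by (intro cInf_lower T_bdd) (simp add: T_def)
  qed
  note eq = this
  show "Grothendieck_bound little_Grothendieck_const" unfolding eq by (rule bound)
  show "little_Grothendieck_const \<le> k" if "Grothendieck_bound k"
    unfolding eq k0_def by (intro cInf_lower T_bdd) (simp add: T_def that)
qed

theorem theorem5p4:
  shows "0 < little_Grothendieck_const \<and>
    (\<forall>n. \<forall>\<alpha>::real. \<alpha> \<ge> little_Grothendieck_const \<longrightarrow> Q_set n \<subseteq> R_minus_psd n \<alpha>) \<and>
    (\<forall>\<beta>::real. 0 < \<beta> \<longrightarrow>
      (\<forall>n. \<forall>\<alpha>::real. \<alpha> \<ge> \<beta> \<longrightarrow> Q_set n \<subseteq> R_minus_psd n \<alpha>) \<longrightarrow>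
      little_Grothendieck_const \<le> \<beta>)"
proof (intro conjI allI impI)
  show pos: "0 < little_Grothendieck_const"
    using Grothendieck_bound_ge_1[OF little_Grothendieck_const_least(1)] by simp
  fix n and \<alpha> :: real assume \<alpha>: "little_Grothendieck_const \<le> \<alpha>"
  show "Q_set n \<subseteq> R_minus_psd n \<alpha>"
    using little_Grothendieck_const_least(1) pos Rdom_mono[OF _ \<alpha>]
    unfolding Grothendieck_bound_iff[OF pos] Q_subset_iff by blast
next
  fix \<beta> :: real
  assume "0 < \<beta>" "\<forall>n. \<forall>\<alpha>\<ge>\<beta>. Q_set n \<subseteq> R_minus_psd n \<alpha>"
  then show "little_Grothendieck_const \<le> \<beta>"
    by (intro little_Grothendieck_const_least(2)) (simp add: Grothendieck_bound_iff)
qed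

end
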